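(* There exists a constant $C$ such that, for all positive integers $n$ and $k$, \[ F(n;k) \leq \big(C k n R(n;k)\big)^{21 n^2} \leq \exp\left(C k n^3 \log k\right). \]
   Context: For graphs $G$ and $H$ and a positive integer $k$, write $G \rightarrow (H)_k$ if for every colouring $c \colon E(G) \to \{1,\dotsc,k\}$ there is an $i \in \{1,\dotsc,k\}$ such that the graph $c^{-1}(i)$ contains $H$ as a subgraph. $R(n;k)$ is the smallest integer $N$ such that $K_N \rightarrow (K_n)_k$ (the $k$-colour Ramsey number of $K_n$). A graph is $K_{n+1}$-free if it does not contain $K_{n+1}$ as a (not necessarily induced) subgraph. The $k$-colour Folkman number for $K_n$ is \[ F(n;k) = \min\big\{N \in \mathbb{N} : G \rightarrow (K_n)_k \text{ for some } K_{n+1}\text{-free } G \subseteq K_N\big\}. \]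
   Formalization: The second inequality is stated only for k ≥ 2 (the first for all n, k ≥ 1): for k = 1 its right-hand side is exp(0) = 1, while F(n;1) = n > 1 for every n ≥ 2, so the printed chain fails for every C. *)

theory Defs
  imports Complex_Main "HOL-Library.Ramsey" "HOL-Library.Extended_Real"
begin

text \<open>A graph is a pair of a vertex set and an edge set, edges being two-element sets of vertices.\<close>

type_synonym 'a graph = "'a set \<times> 'a set set"

abbreviation verts :: "'a graph \<Rightarrow> 'a set" where "verts \<equiv> fst"
abbreviation edges :: "'a graph \<Rightarrow> 'a set set" where "edges \<equiv> snd"

definition is_graph :: "'a graph \<Rightarrow> bool" where
  "is_graph G \<longleftrightarrow> edges G \<subseteq> [verts G]\<^bsup>2\<^esup>"

definition subgraph :: "'a graph \<Rightarrow> 'a graph \<Rightarrow> bool" where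
  "subgraph G H \<longleftrightarrow> is_graph G \<and> is_graph H \<and> verts G \<subseteq> verts H \<and> edges G \<subseteq> edges H"

definition contains_graph :: "'a graph \<Rightarrow> 'b graph \<Rightarrow> bool" where
  "contains_graph G H \<longleftrightarrow>
     (\<exists>f. inj_on f (verts H) \<and> f ` verts H \<subseteq> verts G \<and> (\<forall>e\<in>edges H. f ` e \<in> edges G))"

definition complete_graph :: "nat \<Rightarrow> nat graph" where
  "complete_graph n = ({..<n}, [{..<n}]\<^bsup>2\<^esup>)"

text \<open>A colour class is a spanning subgraph: it keeps all the vertices of the coloured graph. This
  matters only when \<open>H\<close> has isolated vertices, as \<open>K\<^sub>1\<close> does.\<close>

definition colour_class :: "'a graph \<Rightarrow> ('a set \<Rightarrow> nat) \<Rightarrow> nat \<Rightarrow> 'a graph" where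
  "colour_class G c i = (verts G, {e \<in> edges G. c e = i})"

definition ramsey_arrow :: "'a graph \<Rightarrow> 'b graph \<Rightarrow> nat \<Rightarrow> bool" where
  "ramsey_arrow G H k \<longleftrightarrow>
     (\<forall>c \<in> edges G \<rightarrow> {1..k}. \<exists>i\<in>{1..k}. contains_graph (colour_class G c i) H)"

definition ramsey_number :: "nat \<Rightarrow> nat \<Rightarrow> nat" where
  "ramsey_number n k = (LEAST N. ramsey_arrow (complete_graph N) (complete_graph n) k)"

text \<open>The minimum is taken in \<^typ>\<open>enat\<close>, so that it is \<open>\<infinity>\<close> if no suitable graph exists. A finite
  upper bound on \<open>folkman_number n k\<close> thus includes the existence of such a graph.\<close>

definition folkman_number :: "nat \<Rightarrow> nat \<Rightarrow> enat" where
  "folkman_number n k =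
     (INF N \<in> {N. \<exists>G. subgraph G (complete_graph N) \<and>
                     \<not> contains_graph G (complete_graph (n + 1)) \<and>
                     ramsey_arrow G (complete_graph n) k}. enat N)"

end

theory Submission
  imports Defs
begin

text \<open>
  Write \<open>R\<close> for \<^term>\<open>ramsey_number n k\<close>. For \<open>n \<le> 2\<close> the graph \<open>K\<^sub>n\<close> itself will do, so let \<open>n \<ge> 3\<close>. The
  graph is found among the subgraphs of a random graph \<open>G(N,p)\<close>, where \<open>N\<close> is a power of
  \<open>M = 2048 k n R\<close> with exponent quadratic in \<open>n\<close>. Two facts have to be balanced.

  On the one hand, graphs without the arrow property have few \<^emph>\<open>containers\<close>: there is a family of at
  most \<open>exp (p N\<^sup>2 / (8 R\<^sup>2))\<close> graphs, each missing at least \<open>N\<^sup>2 / (2 R\<^sup>2)\<close> edges of \<open>K\<^sub>N\<close>, such that every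
  graph with a \<open>k\<close>-colouring free of monochromatic \<open>K\<^sub>n\<close> lies inside a member of the family
  (\<open>colourable_container_family\<close>). On the other hand, \<open>p\<close> is so small that \<open>G(N,p)\<close> has, in expectation,
  far fewer copies of \<open>K\<^sub>n\<^sub>+\<^sub>1\<close> than it has edges outside any fixed member of the family. By a first moment
  computation some graph has more edges outside every member than it has copies of \<open>K\<^sub>n\<^sub>+\<^sub>1\<close>, and deleting
  one edge from each copy leaves a \<open>K\<^sub>n\<^sub>+\<^sub>1\<close>-free graph contained in no member
  (\<open>random_subset_deletion\<close>).

  The exponent is polynomial in \<open>n\<close> only because the container lemma loses no factor exponential in
  the number of edges of \<open>K\<^sub>n\<close>. Its proof is probabilistic. For a set \<open>S\<close> of vertices already known to lie
  in the independent set \<open>I\<close>, and a set \<open>C\<close> covering the rest of \<open>I\<close>, consider the probability that a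
  \<open>q\<close>-random subset of \<open>C\<close> together with \<open>S\<close> is independent. As long as moving some \<open>v \<in> C\<close> to \<open>S\<close> lowers this
  probability by a factor \<open>1 - \<delta>\<close>, ask whether \<open>v \<in> I\<close>: if so, move it, and if not, discard it. Since the
  probability of the empty set alone is at least \<open>exp (- 2 q |C|)\<close>, at most \<open>2 q |V| / \<delta>\<close> vertices are ever
  moved, and they determine the whole process (\<open>ex_fingerprint\<close>, \<open>containers\<close>).
  When the process stops, the random set conditioned on being independent has marginals almost equal
  to \<open>q\<close>. By a monotone coupling it then arises from the \<open>q\<close>-random set by deleting a proportion of only
  \<open>\<delta>\<close> of its elements on average, yet the deletion destroys every hyperedge inside \<open>C\<close>. So the hyperedges
  inside \<open>C\<close> are few or strongly overlapping (\<open>saturated_second_moment\<close>).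

  For cliques this is applied to one monochromatic \<open>K\<^sub>n\<close> in each of the \<open>R\<close>-subsets of the vertices that
  contain one. Such a family is spread out as evenly as the \<open>R\<close>-sets themselves, which is why the
  loss is a power of \<open>R\<close> independent of \<open>n\<close> (\<open>few_sets_with_clique\<close>).
\<close>

section \<open>Averages over random subsets\<close>

text \<open>The expectation of \<open>f\<close> over the random subset of \<open>C\<close> that contains every element independently
  with probability \<open>p\<close>; a finite sum is all that is needed.\<close>
definition bmean :: "real \<Rightarrow> 'a set \<Rightarrow> ('a set \<Rightarrow> real) \<Rightarrow> real" where
  "bmean p C f = (\<Sum>A\<in>Pow C. p ^ card A * (1 - p) ^ card (C - A) * f A)"

lemma bmean_empty [simp]: "bmean p {} f = f {}"
  by (simp add: bmean_def)

text \<open>Conditioning on the membership of a single element; all inductions over the ground set use it.\<close>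
lemma bmean_insert:
  assumes "finite C" "v \<notin> C"
  shows "bmean p (insert v C) f = (1 - p) * bmean p C f + p * bmean p C (\<lambda>A. f (insert v A))"
proof -
  let ?w = "\<lambda>A. p ^ card A * (1 - p) ^ card (insert v C - A) * f A"
  have inj: "inj_on (insert v) (Pow C)"
    using assms(2) by (auto simp: inj_on_def)
  have disj: "Pow C \<inter> insert v ` Pow C = {}"
    using assms(2) by auto
  have "bmean p (insert v C) f = sum ?w (Pow C) + sum ?w (insert v ` Pow C)"
    unfolding bmean_def Pow_insert using assms disj by (intro sum.union_disjoint) auto
  also have "sum ?w (insert v ` Pow C) = (\<Sum>A\<in>Pow C. ?w (insert v A))"
    using inj by (simp add: sum.reindex)
  also have "\<dots> = p * bmean p C (\<lambda>A. f (insert v A))"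
    unfolding bmean_def sum_distrib_left
  proof (intro sum.cong refl)
    fix A assume "A \<in> Pow C"
    then have A: "A \<subseteq> C" "finite A" "v \<notin> A" "insert v C - insert v A = C - A"
      using assms by (auto intro: finite_subset)
    then show "?w (insert v A) = p * (p ^ card A * (1 - p) ^ card (C - A) * f (insert v A))"
      by simp
  qed
  also have "sum ?w (Pow C) = (1 - p) * bmean p C f"
    unfolding bmean_def sum_distrib_left
  proof (intro sum.cong refl)
    fix A assume "A \<in> Pow C"
    then have A: "finite (C - A)" "v \<notin> C - A" "insert v C - A = insert v (C - A)"
      using assms by auto
    then show "?w A = (1 - p) * (p ^ card A * (1 - p) ^ card (C - A) * f A)"
      by simp
  qed
  finally show ?thesis .
qed

lemma bmean_remove:
  assumes "finite C" "v \<in> C"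
  shows "bmean p C f = (1 - p) * bmean p (C - {v}) f + p * bmean p (C - {v}) (\<lambda>A. f (insert v A))"
  using bmean_insert[of "C - {v}" v p f] assms by (simp add: insert_absorb)

lemma bmean_cong: "(\<And>A. A \<subseteq> C \<Longrightarrow> f A = g A) \<Longrightarrow> bmean p C f = bmean p C g"
  unfolding bmean_def by (intro sum.cong) auto

lemma bmean_mono:
  assumes "0 \<le> p" "p \<le> 1" "\<And>A. A \<subseteq> C \<Longrightarrow> f A \<le> g A"
  shows "bmean p C f \<le> bmean p C g"
  unfolding bmean_def using assms by (intro sum_mono mult_left_mono) auto

lemma bmean_add: "bmean p C (\<lambda>A. f A + g A) = bmean p C f + bmean p C g"
  unfolding bmean_def by (simp add: sum.distrib algebra_simps)

lemma bmean_cmult: "bmean p C (\<lambda>A. c * f A) = c * bmean p C f"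
  unfolding bmean_def by (simp add: sum_distrib_left algebra_simps)

lemma bmean_sum: "bmean p C (\<lambda>A. \<Sum>i\<in>I. f i A) = (\<Sum>i\<in>I. bmean p C (f i))"
  unfolding bmean_def sum_distrib_left by (rule sum.swap)

lemma bmean_prod:
  assumes "finite C"
  shows "bmean p C (\<lambda>A. \<Prod>v\<in>A. x v) = (\<Prod>v\<in>C. 1 - p + p * x v)"
  using assms
proof (induction C rule: finite_induct)
  case (insert v C)
  have "bmean p C (\<lambda>A. \<Prod>u\<in>insert v A. x u) = bmean p C (\<lambda>A. x v * (\<Prod>u\<in>A. x u))"
    using insert.hyps by (intro bmean_cong) (subst prod.insert, auto intro: finite_subset)
  then show ?case
    using insert by (simp add: bmean_insert bmean_cmult algebra_simps)
qed simp

lemma bmean_const: "finite C \<Longrightarrow> bmean p C (\<lambda>A. c) = c"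
  using bmean_prod[of C p "\<lambda>_. 1"] bmean_cmult[of p C c "\<lambda>_. 1"] by simp

lemma bmean_superset:
  assumes "finite C" "L \<subseteq> C"
  shows "bmean p C (\<lambda>A. of_bool (L \<subseteq> A)) = p ^ card L"
  using assms
proof (induction C arbitrary: L rule: finite_induct)
  case (insert v C)
  have eq: "(L \<subseteq> insert v A) = (L - {v} \<subseteq> A)" for A by auto
  have IH: "bmean p C (\<lambda>A. of_bool (L - {v} \<subseteq> A)) = p ^ card (L - {v})"
    using insert by (intro insert.IH) auto
  show ?case
  proof (cases "v \<in> L")
    case True
    have "bmean p C (\<lambda>A. of_bool (L \<subseteq> A)) = bmean p C (\<lambda>A. 0)"
      using True insert.hyps by (intro bmean_cong) auto
    moreover have "card L = Suc (card (L - {v}))"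
      using True insert.hyps(1) insert.prems by (metis card_Suc_Diff1 finite_insert finite_subset)
    ultimately show ?thesis
      using insert.hyps IH by (simp add: bmean_insert eq bmean_const)
  next
    case False
    then have "L - {v} = L" by simp
    then show ?thesis
      using insert.hyps IH by (simp add: bmean_insert eq algebra_simps)
  qed
qed simp

text \<open>Stochastic domination in dual form: the random set conditioned on a decreasing property \<open>F\<close> can be
  coupled with the unconditioned one so as to be a subset of it. Instead of constructing the
  coupling, the lemma compares the means of any \<open>f\<close> and \<open>g\<close> that are ordered along all pairs that the
  coupling may use. In the induction, the conditioned set contains \<open>v\<close> with probability at most \<open>p\<close>,
  because adding \<open>v\<close> makes \<open>F\<close> harder to satisfy; so the pairs \<open>(A, B)\<close> split according to whether \<open>v\<close> is in
  neither, in \<open>A\<close> only, or in both.\<close>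
lemma bmean_le_bmean_conditioned_down_closed:
  assumes "finite C" "0 \<le> p" "p \<le> 1"
    and "\<And>A B. F B \<Longrightarrow> A \<subseteq> B \<Longrightarrow> F A"
    and "\<And>A B. B \<subseteq> A \<Longrightarrow> A \<subseteq> C \<Longrightarrow> F B \<Longrightarrow> f A \<le> g B"
  shows "bmean p C f * bmean p C (\<lambda>B. of_bool (F B)) \<le> bmean p C (\<lambda>B. of_bool (F B) * g B)"
  using assms(1,4,5)
proof (induction C arbitrary: F f g rule: finite_induct)
  case empty
  show ?case using empty(2)[of "{}" "{}"] by simp
next
  case (insert v C)
  define e0 where "e0 = bmean p C f"
  define e1 where "e1 = bmean p C (\<lambda>A. f (insert v A))"
  define z0 where "z0 = bmean p C (\<lambda>B. of_bool (F B))"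
  define z1 where "z1 = bmean p C (\<lambda>B. of_bool (F (insert v B)))"
  define g0 where "g0 = bmean p C (\<lambda>B. of_bool (F B) * g B)"
  define g1 where "g1 = bmean p C (\<lambda>B. of_bool (F (insert v B)) * g (insert v B))"
  have down1: "F (insert v B) \<Longrightarrow> A \<subseteq> B \<Longrightarrow> F (insert v A)" for A B
    using insert.prems(1) by (meson insert_mono)
  have 1: "e0 * z0 \<le> g0"
    unfolding e0_def z0_def g0_def
    by (rule insert.IH) (blast intro: insert.prems(1), rule insert.prems(2), auto)
  have 2: "e1 * z0 \<le> g0"
    unfolding e1_def z0_def g0_def
    by (rule insert.IH) (blast intro: insert.prems(1), rule insert.prems(2), auto)
  have 3: "e1 * z1 \<le> g1"
    unfolding e1_def z1_def g1_def
    by (rule insert.IH) (blast intro: down1, rule insert.prems(2), auto)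
  have "z1 \<le> z0"
    unfolding z0_def z1_def using assms(2,3) insert.prems(1)[OF _ subset_insertI]
    by (intro bmean_mono) auto
  have "z1 \<ge> 0"
    unfolding z1_def bmean_def using assms(2,3) by (intro sum_nonneg) auto
  \<comment> \<open>Both \<open>e0\<close> and \<open>e1\<close> may be negative, so they are compared through their maximum.\<close>
  define mx where "mx = max e0 e1"
  have 4: "mx * z0 \<le> g0" using 1 2 by (auto simp: mx_def max_def)
  have "((1 - p) * e0 + p * e1) * ((1 - p) * z0 + p * z1)
      = p * (e1 * z1) + (1 - p) * (e0 * ((1 - p) * z0 + p * z1) + e1 * (p * (z0 - z1)))"
    by algebra
  also have "\<dots> \<le> p * (e1 * z1) + (1 - p) * (mx * ((1 - p) * z0 + p * z1) + mx * (p * (z0 - z1)))"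
    using assms(2,3) \<open>z1 \<le> z0\<close> \<open>z1 \<ge> 0\<close>
    by (intro add_mono mult_left_mono mult_right_mono) (auto simp: mx_def)
  also have "\<dots> = p * (e1 * z1) + (1 - p) * (mx * z0)"
    by algebra
  also have "\<dots> \<le> p * g1 + (1 - p) * g0"
    using assms(2,3) 3 4 by (intro add_mono mult_left_mono) auto
  finally show ?case
    using insert.hyps by (simp add: bmean_insert e0_def e1_def z0_def z1_def g0_def g1_def)
qed

section \<open>Containers with short fingerprints\<close>

definition indep_prob :: "real \<Rightarrow> 'a set set \<Rightarrow> 'a set \<Rightarrow> 'a set \<Rightarrow> real" where
  "indep_prob q \<I> C S = bmean q C (\<lambda>A. of_bool (A \<union> S \<in> \<I>))"

text \<open>No single element of \<open>C\<close> has much influence: given that the \<open>q\<close>-random subset of \<open>C\<close> is independent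
  together with \<open>S\<close>, it contains each element of \<open>C\<close> with probability at least \<open>(1 - \<delta>) q\<close>.\<close>
definition saturated :: "real \<Rightarrow> real \<Rightarrow> 'a set set \<Rightarrow> 'a set \<Rightarrow> 'a set \<Rightarrow> bool" where
  "saturated q \<delta> \<I> C S \<longleftrightarrow>
     (\<forall>v\<in>C. (1 - \<delta>) * indep_prob q \<I> C S \<le> indep_prob q \<I> (C - {v}) (insert v S))"

lemma indep_prob_remove:
  assumes "finite C" "v \<in> C" "0 \<le> q" "q \<le> 1"
  shows "(1 - q) * indep_prob q \<I> (C - {v}) S \<le> indep_prob q \<I> C S"
proof -
  have "indep_prob q \<I> C S = (1 - q) * indep_prob q \<I> (C - {v}) S
      + q * bmean q (C - {v}) (\<lambda>A. of_bool (insert v A \<union> S \<in> \<I>))"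
    unfolding indep_prob_def using bmean_remove[OF assms(1,2)] by blast
  moreover have "bmean q (C - {v}) (\<lambda>A. of_bool (insert v A \<union> S \<in> \<I>)) \<ge> 0"
    unfolding bmean_def using assms by (intro sum_nonneg) auto
  ultimately show ?thesis using assms by simp
qed

lemma indep_prob_le_1: "finite C \<Longrightarrow> 0 \<le> q \<Longrightarrow> q \<le> 1 \<Longrightarrow> indep_prob q \<I> C S \<le> 1"
  unfolding indep_prob_def using bmean_mono[of q C _ "\<lambda>_. 1"] by (simp add: bmean_const)

lemma indep_prob_ge_empty:
  assumes "finite C" "0 \<le> q" "q \<le> 1" "S \<in> \<I>"
  shows "(1 - q) ^ card C \<le> indep_prob q \<I> C S"
proof -
  have "(\<Sum>A\<in>{{}}. q ^ card A * (1 - q) ^ card (C - A) * of_bool (A \<union> S \<in> \<I>)) \<le> indep_prob q \<I> C S"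
    unfolding indep_prob_def bmean_def using assms by (intro sum_mono2) auto
  then show ?thesis using assms by simp
qed

text \<open>The conditions on the part \<open>T\<close> of \<open>I\<close> recorded by the process started from \<open>(C, S)\<close>. That \<open>g\<close> is applied
  to \<open>T\<close> alone expresses that the container depends on \<open>I\<close> only through \<open>T\<close>. The last conjunct bounds the
  size of \<open>T\<close>: each recorded element costs a factor \<open>1 - \<delta>\<close>.\<close>
definition fingerprint :: "real \<Rightarrow> real \<Rightarrow> 'a set set \<Rightarrow> 'a set \<Rightarrow> 'a set \<Rightarrow> 'a set \<Rightarrow> ('a set \<Rightarrow> 'a set) \<Rightarrow> 'a set \<Rightarrow> bool" where
  "fingerprint q \<delta> \<I> C S I g T \<longleftrightarrow>
     T \<subseteq> I \<inter> C \<and> I \<subseteq> S \<union> T \<union> g T \<and> g T \<subseteq> C \<and> saturated q \<delta> \<I> (g T) (S \<union> T) \<and> S \<union> T \<in> \<I> \<and>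
     (1 - q) ^ card C \<le> (1 - \<delta>) ^ card T * indep_prob q \<I> C S"

text \<open>An influential \<open>v \<in> C\<close> is moved to \<open>S\<close> if it lies in \<open>I\<close> and is discarded otherwise. The function \<open>g\<close> can
  replay the run from \<open>T\<close>, since \<open>v \<in> I\<close> holds iff \<open>v \<in> T\<close>. Discarding \<open>v\<close> multiplies the probability of
  independence by at most \<open>1 / (1 - q)\<close>, which is exactly the factor by which the lower bound
  \<open>(1 - q) ^ card C\<close> changes.\<close>
lemma ex_fingerprint:
  assumes "finite C" "0 \<le> q" "q \<le> 1" "0 < \<delta>" "\<delta> < 1" "\<And>A B. B \<in> \<I> \<Longrightarrow> A \<subseteq> B \<Longrightarrow> A \<in> \<I>"
  shows "\<exists>g. \<forall>I\<in>\<I>. S \<subseteq> I \<and> I \<subseteq> S \<union> C \<longrightarrow> (\<exists>T. fingerprint q \<delta> \<I> C S I g T)"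
  using assms(1)
proof (induction "card C" arbitrary: C S)
  case 0
  then have "C = {}" by simp
  have "fingerprint q \<delta> \<I> C S I (\<lambda>_. {}) {}" if "I \<in> \<I>" "S \<subseteq> I" "I \<subseteq> S \<union> C" for I
    using that assms(6)[OF that(1,2)] \<open>C = {}\<close>
    by (simp add: fingerprint_def saturated_def indep_prob_def)
  then show ?case by blast
next
  case (Suc m C S)
  show ?case
  proof (cases "saturated q \<delta> \<I> C S")
    case True
    have "fingerprint q \<delta> \<I> C S I (\<lambda>_. C) {}" if "I \<in> \<I>" "S \<subseteq> I" "I \<subseteq> S \<union> C" for I
      using that True assms(6)[OF that(1,2)] indep_prob_ge_empty[OF Suc.prems assms(2,3)]
      by (simp add: fingerprint_def)
    then show ?thesis by blast
  next
    case False
    then obtain v where v: "v \<in> C"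
      and drop: "indep_prob q \<I> (C - {v}) (insert v S) < (1 - \<delta>) * indep_prob q \<I> C S"
      by (auto simp: saturated_def not_le)
    let ?C = "C - {v}"
    have card: "card C = Suc (card ?C)"
      using Suc.prems v by (metis card_Suc_Diff1)
    have fin: "finite ?C" and m: "m = card ?C"
      using Suc.hyps(2) Suc.prems card by simp_all
    obtain g0 where g0: "\<forall>I\<in>\<I>. S \<subseteq> I \<and> I \<subseteq> S \<union> ?C \<longrightarrow> (\<exists>T. fingerprint q \<delta> \<I> ?C S I g0 T)"
      using Suc.hyps(1)[OF m fin] by blast
    obtain g1 where g1: "\<forall>I\<in>\<I>. insert v S \<subseteq> I \<and> I \<subseteq> insert v S \<union> ?C \<longrightarrow>
        (\<exists>T. fingerprint q \<delta> \<I> ?C (insert v S) I g1 T)"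
      using Suc.hyps(1)[OF m fin] by blast
    define g where "g T = (if v \<in> T then g1 (T - {v}) else g0 T)" for T
    have "\<exists>T. fingerprint q \<delta> \<I> C S I g T" if I: "I \<in> \<I>" "S \<subseteq> I" "I \<subseteq> S \<union> C" for I
    proof (cases "v \<in> I")
      case True
      then have "insert v S \<subseteq> I" "I \<subseteq> insert v S \<union> ?C" using I by auto
      then obtain T where "fingerprint q \<delta> \<I> ?C (insert v S) I g1 T"
        using g1 I(1) by blast
      then have T: "T \<subseteq> I \<inter> ?C" "I \<subseteq> insert v S \<union> T \<union> g1 T" "g1 T \<subseteq> ?C"
        "saturated q \<delta> \<I> (g1 T) (insert v S \<union> T)" "insert v S \<union> T \<in> \<I>"
        "(1 - q) ^ card ?C \<le> (1 - \<delta>) ^ card T * indep_prob q \<I> ?C (insert v S)"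
        by (simp_all add: fingerprint_def)
      have "v \<notin> T" "finite T" using T(1) fin by (auto intro: finite_subset)
      then have gT: "g (insert v T) = g1 T" by (simp add: g_def)
      have "(1 - q) ^ card C \<le> (1 - q) ^ card ?C"
        using assms(2,3) by (intro power_decreasing) (auto simp: card)
      also have "\<dots> \<le> (1 - \<delta>) ^ card T * indep_prob q \<I> ?C (insert v S)" by (rule T(6))
      also have "\<dots> \<le> (1 - \<delta>) ^ card T * ((1 - \<delta>) * indep_prob q \<I> C S)"
        using drop assms(5) by (intro mult_left_mono) auto
      also have "\<dots> = (1 - \<delta>) ^ card (insert v T) * indep_prob q \<I> C S"
        using \<open>v \<notin> T\<close> \<open>finite T\<close> by simp
      finally have "fingerprint q \<delta> \<I> C S I g (insert v T)"
        unfolding fingerprint_def gT using T(1-5) v True by auto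
      then show ?thesis ..
    next
      case False
      then have "I \<subseteq> S \<union> ?C" using I by auto
      then obtain T where "fingerprint q \<delta> \<I> ?C S I g0 T"
        using g0 I by blast
      then have T: "T \<subseteq> I \<inter> ?C" "I \<subseteq> S \<union> T \<union> g0 T" "g0 T \<subseteq> ?C"
        "saturated q \<delta> \<I> (g0 T) (S \<union> T)" "S \<union> T \<in> \<I>"
        "(1 - q) ^ card ?C \<le> (1 - \<delta>) ^ card T * indep_prob q \<I> ?C S"
        by (simp_all add: fingerprint_def)
      have gT: "g T = g0 T" using T(1) by (auto simp: g_def)
      have "(1 - q) ^ card C \<le> (1 - q) * ((1 - \<delta>) ^ card T * indep_prob q \<I> ?C S)"
        using assms(3) T(6) by (simp add: card mult_left_mono)
      also have "\<dots> = (1 - \<delta>) ^ card T * ((1 - q) * indep_prob q \<I> ?C S)" by simp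
      also have "\<dots> \<le> (1 - \<delta>) ^ card T * indep_prob q \<I> C S"
        using indep_prob_remove[OF Suc.prems v assms(2,3)] assms(5) by (intro mult_left_mono) auto
      finally have "fingerprint q \<delta> \<I> C S I g T"
        unfolding fingerprint_def gT using T(1-5) by auto
      then show ?thesis ..
    qed
    then show ?thesis by blast
  qed
qed

text \<open>Take the optimal \<open>t\<close>; the degenerate cases are those in which no optimal \<open>t\<close> exists.\<close>
lemma square_le_if_quadratic_le:
  fixes \<mu> \<Delta> c :: real
  assumes "\<And>t. t > 0 \<Longrightarrow> 2 * t * \<mu> - t\<^sup>2 * \<Delta> \<le> c" "\<mu> \<ge> 0" "\<Delta> \<ge> 0"
  shows "\<mu>\<^sup>2 \<le> c * \<Delta>"
proof (cases "\<mu> = 0")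
  case True
  have "c \<ge> 0"
  proof (rule ccontr)
    assume "\<not> c \<ge> 0"
    define t where "t = min 1 (- c / (2 * (\<Delta> + 1)))"
    have t: "0 < t" "t \<le> 1" "t \<le> - c / (2 * (\<Delta> + 1))"
      using \<open>\<not> c \<ge> 0\<close> assms(3) by (auto simp: t_def divide_neg_pos)
    have "t\<^sup>2 * \<Delta> \<le> t * \<Delta>"
      using t assms(3) by (intro mult_right_mono) (auto simp: power2_eq_square mult_le_one)
    also have "\<dots> \<le> t * (\<Delta> + 1)" using t by simp
    also have "\<dots> \<le> - c / 2"
      using t(3) assms(3) by (simp add: field_simps)
    finally show False using assms(1)[OF t(1)] True \<open>\<not> c \<ge> 0\<close> by simp
  qed
  then show ?thesis using True assms(3) by simp
next
  case False
  then have "\<mu> > 0" using assms(2) by simp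
  show ?thesis
  proof (cases "\<Delta> = 0")
    case True
    have "2 * ((\<bar>c\<bar> + 1) / \<mu>) * \<mu> \<le> c"
      using assms(1)[of "(\<bar>c\<bar> + 1) / \<mu>"] True \<open>\<mu> > 0\<close> by (simp add: divide_pos_pos)
    then show ?thesis using \<open>\<mu> > 0\<close> by simp
  next
    case False
    then have "\<Delta> > 0" using assms(3) by simp
    have "2 * (\<mu> / \<Delta>) * \<mu> - (\<mu> / \<Delta>)\<^sup>2 * \<Delta> = \<mu>\<^sup>2 / \<Delta>"
      using \<open>\<Delta> > 0\<close> by (simp add: power2_eq_square field_simps)
    then have "\<mu>\<^sup>2 / \<Delta> \<le> c"
      using assms(1)[of "\<mu> / \<Delta>"] \<open>\<mu> > 0\<close> \<open>\<Delta> > 0\<close> by simp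
    then show ?thesis
      using \<open>\<Delta> > 0\<close> by (simp add: pos_divide_le_eq)
  qed
qed

lemma bmean_card:
  assumes "finite C"
  shows "bmean p C (\<lambda>A. of_bool (F A) * real (card A))
    = (\<Sum>v\<in>C. p * bmean p (C - {v}) (\<lambda>A. of_bool (F (insert v A))))"
proof -
  have "bmean p C (\<lambda>A. of_bool (F A) * real (card A))
      = bmean p C (\<lambda>A. \<Sum>v\<in>C. of_bool (F A \<and> v \<in> A))"
  proof (intro bmean_cong)
    fix A assume "A \<subseteq> C"
    then have "C \<inter> {v. v \<in> A} = A" by auto
    then show "of_bool (F A) * real (card A) = (\<Sum>v\<in>C. of_bool (F A \<and> v \<in> A))"
      using assms by (cases "F A") (auto simp: of_bool_def sum.If_cases)
  qed
  also have "\<dots> = (\<Sum>v\<in>C. bmean p C (\<lambda>A. of_bool (F A \<and> v \<in> A)))"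
    by (rule bmean_sum)
  also have "\<dots> = (\<Sum>v\<in>C. p * bmean p (C - {v}) (\<lambda>A. of_bool (F (insert v A))))"
  proof (intro sum.cong refl)
    fix v assume "v \<in> C"
    have "bmean p (C - {v}) (\<lambda>A. of_bool (F A \<and> v \<in> A)) = bmean p (C - {v}) (\<lambda>A. 0)"
      by (intro bmean_cong) auto
    then show "bmean p C (\<lambda>A. of_bool (F A \<and> v \<in> A))
        = p * bmean p (C - {v}) (\<lambda>A. of_bool (F (insert v A)))"
      using bmean_remove[OF assms \<open>v \<in> C\<close>, of p "\<lambda>A. of_bool (F A \<and> v \<in> A)"] assms
      by (simp add: bmean_const)
  qed
  finally show ?thesis .
qed

text \<open>Let \<open>A\<close> be the \<open>q\<close>-random subset of \<open>C\<close> and \<open>B \<subseteq> A\<close> the conditioned set coupled with it. No \<open>K y\<close> is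
  contained in \<open>B\<close>, so each \<open>K y \<subseteq> A\<close> contains an element of \<open>A - B\<close>, and the number of such \<open>y\<close> is at most
  the sum of the degrees over \<open>A - B\<close>. Now \<open>A - B\<close> has at most \<open>\<delta> q |C|\<close> elements on average by
  saturation, and the Cauchy--Schwarz inequality bounds the sum of the degrees by their second
  moment, which is the double sum on the right.\<close>
lemma saturated_second_moment:
  fixes q \<delta> :: real
  assumes C: "finite C" and q: "0 \<le> q" "q < 1"
    and down: "\<And>A B. B \<in> \<I> \<Longrightarrow> A \<subseteq> B \<Longrightarrow> A \<in> \<I>"
    and sat: "saturated q \<delta> \<I> C S" "S \<in> \<I>"
    and J: "finite J" "\<And>y. y \<in> J \<Longrightarrow> K y \<subseteq> C" "\<And>y. y \<in> J \<Longrightarrow> K y \<notin> \<I>"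
  shows "(\<Sum>y\<in>J. q ^ card (K y))\<^sup>2
    \<le> (\<delta> * q * card C) * (\<Sum>x\<in>J. \<Sum>y\<in>J. card (K x \<inter> K y) * q ^ card (K x \<union> K y))"
proof -
  define X where "X A = (\<Sum>y\<in>J. of_bool (K y \<subseteq> A) :: real)" for A
  define deg where "deg v A = (\<Sum>y\<in>J. of_bool (v \<in> K y \<and> K y \<subseteq> A) :: real)" for v A
  define Y where "Y A = (\<Sum>v\<in>C. (deg v A)\<^sup>2)" for A
  define \<mu> where "\<mu> = (\<Sum>y\<in>J. q ^ card (K y))"
  define \<Delta> where "\<Delta> = (\<Sum>x\<in>J. \<Sum>y\<in>J. card (K x \<inter> K y) * q ^ card (K x \<union> K y))"
  define z where "z = indep_prob q \<I> C S"
  have "(1 - q) ^ card C > 0" using q by simp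
  then have z: "z > 0"
    using indep_prob_ge_empty[of C q S \<I>] C q sat(2) unfolding z_def by linarith
  have X_mean: "bmean q C X = \<mu>"
    unfolding X_def \<mu>_def bmean_sum using J C by (intro sum.cong) (auto intro: bmean_superset)
  have Y_eq: "Y A = (\<Sum>x\<in>J. \<Sum>y\<in>J. real (card (K x \<inter> K y)) * of_bool (K x \<union> K y \<subseteq> A))" for A
  proof -
    have "Y A = (\<Sum>v\<in>C. \<Sum>x\<in>J. \<Sum>y\<in>J. of_bool (v \<in> K x \<inter> K y) * of_bool (K x \<union> K y \<subseteq> A))"
      unfolding Y_def deg_def power2_eq_square sum_product
      by (intro sum.cong refl) (auto simp: of_bool_def)
    also have "\<dots> = (\<Sum>x\<in>J. \<Sum>v\<in>C. \<Sum>y\<in>J. of_bool (v \<in> K x \<inter> K y) * of_bool (K x \<union> K y \<subseteq> A))"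
      by (rule sum.swap)
    also have "\<dots> = (\<Sum>x\<in>J. \<Sum>y\<in>J. \<Sum>v\<in>C. of_bool (v \<in> K x \<inter> K y) * of_bool (K x \<union> K y \<subseteq> A))"
      by (intro sum.cong refl sum.swap)
    also have "\<dots> = (\<Sum>x\<in>J. \<Sum>y\<in>J. real (card (K x \<inter> K y)) * of_bool (K x \<union> K y \<subseteq> A))"
    proof (intro sum.cong refl)
      fix x y assume "x \<in> J" "y \<in> J"
      then have "C \<inter> {v. v \<in> K x \<inter> K y} = K x \<inter> K y" using J by auto
      then have "(\<Sum>v\<in>C. of_bool (v \<in> K x \<inter> K y)) = real (card (K x \<inter> K y))"
        using C by (simp add: of_bool_def sum.If_cases)
      then show "(\<Sum>v\<in>C. of_bool (v \<in> K x \<inter> K y) * of_bool (K x \<union> K y \<subseteq> A))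
          = real (card (K x \<inter> K y)) * of_bool (K x \<union> K y \<subseteq> A)"
        by (simp only: flip: sum_distrib_right)
    qed
    finally show ?thesis .
  qed
  have Y_mean: "bmean q C Y = \<Delta>"
    unfolding Y_eq \<Delta>_def bmean_sum bmean_cmult
  proof (intro sum.cong refl)
    fix x y assume "x \<in> J" "y \<in> J"
    then show "real (card (K x \<inter> K y)) * bmean q C (\<lambda>A. of_bool (K x \<union> K y \<subseteq> A))
        = real (card (K x \<inter> K y)) * q ^ card (K x \<union> K y)"
      using bmean_superset[OF C, of "K x \<union> K y" q] J by simp
  qed
  have card_mean: "bmean q C (\<lambda>A. real (card A)) = q * card C"
    using bmean_card[OF C, of q "\<lambda>_. True"] C by (simp add: bmean_const)
  have "2 * t * \<mu> - t\<^sup>2 * \<Delta> \<le> \<delta> * q * card C" if "t > 0" for t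
  proof -
    \<comment> \<open>Linearised Cauchy--Schwarz: \<open>2 t d \<le> t\<^sup>2 d\<^sup>2 + 1\<close> for each degree \<open>d\<close>, where \<open>t\<close> is optimised at the end.\<close>
    define f where "f A = 2 * t * X A + (- t\<^sup>2) * Y A + (- 1) * real (card A)" for A
    have le: "f A \<le> - real (card B)" if BA: "B \<subseteq> A" "A \<subseteq> C" "B \<union> S \<in> \<I>" for A B
    proof -
      have fin: "finite A" "finite B" using BA C by (auto intro: finite_subset)
      have "X A \<le> (\<Sum>y\<in>J. \<Sum>v\<in>A - B. of_bool (v \<in> K y \<and> K y \<subseteq> A))"
        unfolding X_def
      proof (intro sum_mono)
        fix y assume "y \<in> J"
        show "of_bool (K y \<subseteq> A) \<le> (\<Sum>v\<in>A - B. of_bool (v \<in> K y \<and> K y \<subseteq> A) :: real)"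
        proof (cases "K y \<subseteq> A")
          case True
          have "\<not> K y \<subseteq> B"
            using J(3)[OF \<open>y \<in> J\<close>] down[OF BA(3), of "K y"] by blast
          then obtain v where v: "v \<in> A - B" "v \<in> K y" using True by blast
          have "of_bool (v \<in> K y \<and> K y \<subseteq> A) \<le> (\<Sum>v\<in>A - B. of_bool (v \<in> K y \<and> K y \<subseteq> A) :: real)"
            using v fin by (intro member_le_sum) auto
          then show ?thesis using v True by simp
        qed (auto intro: sum_nonneg)
      qed
      also have "\<dots> = (\<Sum>v\<in>A - B. deg v A)"
        unfolding deg_def by (rule sum.swap)
      finally have "2 * t * X A \<le> 2 * t * (\<Sum>v\<in>A - B. deg v A)"
        using \<open>t > 0\<close> by simp
      also have "\<dots> = (\<Sum>v\<in>A - B. 2 * t * deg v A)" by (simp add: sum_distrib_left)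
      also have "\<dots> \<le> (\<Sum>v\<in>A - B. t\<^sup>2 * (deg v A)\<^sup>2 + 1)"
      proof (intro sum_mono)
        fix v
        have "0 \<le> (t * deg v A - 1)\<^sup>2" by simp
        then show "2 * t * deg v A \<le> t\<^sup>2 * (deg v A)\<^sup>2 + 1"
          by (simp add: power2_eq_square algebra_simps)
      qed
      also have "\<dots> = t\<^sup>2 * (\<Sum>v\<in>A - B. (deg v A)\<^sup>2) + real (card (A - B))"
        by (simp add: sum.distrib sum_distrib_left)
      also have "\<dots> \<le> t\<^sup>2 * Y A + real (card (A - B))"
        unfolding Y_def using BA C by (intro add_right_mono mult_left_mono sum_mono2) auto
      also have "real (card (A - B)) = real (card A) - real (card B)"
        using BA(1) fin by (simp add: card_Diff_subset card_mono of_nat_diff)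
      finally show ?thesis by (simp add: f_def)
    qed
    have "bmean q C f * z \<le> bmean q C (\<lambda>B. of_bool (B \<union> S \<in> \<I>) * - real (card B))"
      unfolding z_def indep_prob_def
    proof (rule bmean_le_bmean_conditioned_down_closed[OF C])
      show "A \<union> S \<in> \<I>" if "B \<union> S \<in> \<I>" "A \<subseteq> B" for A B
        using down[OF that(1)] that(2) by blast
    qed (use q le in auto)
    also have "\<dots> = - bmean q C (\<lambda>B. of_bool (B \<union> S \<in> \<I>) * real (card B))"
      using bmean_cmult[of q C "-1" "\<lambda>B. of_bool (B \<union> S \<in> \<I>) * real (card B)"] by simp
    also have "\<dots> = - (\<Sum>v\<in>C. q * indep_prob q \<I> (C - {v}) (insert v S))"
      using bmean_card[OF C, of q "\<lambda>B. B \<union> S \<in> \<I>"] by (simp add: indep_prob_def)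
    also have "\<dots> \<le> - (\<Sum>v\<in>C. q * ((1 - \<delta>) * z))"
      using sat(1) q unfolding saturated_def z_def
      by (intro iffD2[OF neg_le_iff_le] sum_mono mult_left_mono) auto
    also have "\<dots> = - (q * card C * (1 - \<delta>)) * z" by simp
    finally have "bmean q C f \<le> - (q * card C * (1 - \<delta>))"
      using z by (rule mult_right_le_imp_le)
    moreover have "bmean q C f = 2 * t * \<mu> - t\<^sup>2 * \<Delta> - q * card C"
      unfolding f_def bmean_add bmean_cmult X_mean Y_mean card_mean by simp
    ultimately show ?thesis by (simp add: algebra_simps)
  qed
  then show ?thesis
    unfolding \<mu>_def[symmetric] \<Delta>_def[symmetric]
    by (rule square_le_if_quadratic_le) (use q in \<open>auto simp: \<mu>_def \<Delta>_def intro!: sum_nonneg\<close>)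
qed

text \<open>The fingerprints are short because \<open>(1 - q) ^ card V \<le> (1 - \<delta>) ^ card T\<close>.\<close>
lemma containers:
  fixes q \<delta> :: real
  assumes "finite V" "0 < q" "q \<le> 1 / 2" "0 < \<delta>" "\<delta> < 1"
    and "\<And>A B. B \<in> \<I> \<Longrightarrow> A \<subseteq> B \<Longrightarrow> A \<in> \<I>"
  shows "\<exists>g. \<forall>I\<in>\<I>. I \<subseteq> V \<longrightarrow>
    (\<exists>T. T \<subseteq> V \<and> \<delta> * card T \<le> 2 * q * card V \<and> T \<in> \<I> \<and> I \<subseteq> T \<union> g T \<and> g T \<subseteq> V \<and> saturated q \<delta> \<I> (g T) T)"
proof -
  have "\<exists>g. \<forall>I\<in>\<I>. {} \<subseteq> I \<and> I \<subseteq> {} \<union> V \<longrightarrow> (\<exists>T. fingerprint q \<delta> \<I> V {} I g T)"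
    by (rule ex_fingerprint) (use assms(1-5) in simp_all, rule assms(6))
  then obtain g where g: "\<exists>T. fingerprint q \<delta> \<I> V {} I g T" if "I \<in> \<I>" "I \<subseteq> V" for I
    by auto
  have "\<exists>T. T \<subseteq> V \<and> \<delta> * card T \<le> 2 * q * card V \<and> T \<in> \<I> \<and> I \<subseteq> T \<union> g T \<and> g T \<subseteq> V \<and> saturated q \<delta> \<I> (g T) T"
    if "I \<in> \<I>" "I \<subseteq> V" for I
  proof -
    obtain T where T: "fingerprint q \<delta> \<I> V {} I g T" using g[OF \<open>I \<in> \<I>\<close> \<open>I \<subseteq> V\<close>] by blast
    have "(1 - q) ^ card V \<le> (1 - \<delta>) ^ card T * indep_prob q \<I> V {}"
      using T by (simp add: fingerprint_def)
    also have "\<dots> \<le> (1 - \<delta>) ^ card T"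
      using indep_prob_le_1[OF assms(1), of q \<I> "{}"] assms by (simp add: mult_left_le)
    also have "\<dots> \<le> exp (- \<delta>) ^ card T"
      using assms exp_ge_add_one_self[of "- \<delta>"] by (intro power_mono) auto
    also have "\<dots> = exp (- (\<delta> * card T))" by (simp flip: exp_of_nat_mult)
    finally have 1: "(1 - q) ^ card V \<le> exp (- (\<delta> * card T))" .
    have "exp (- 2 * q) \<le> 1 - q"
    proof -
      have "(1 - q) * (1 + 2 * q) = 1 + q * (1 - 2 * q)" by algebra
      then have "1 \<le> (1 - q) * (1 + 2 * q)" using assms(2,3) by simp
      also have "\<dots> \<le> (1 - q) * exp (2 * q)"
        using assms exp_ge_add_one_self[of "2 * q"] by (intro mult_left_mono) auto
      finally show ?thesis by (simp add: exp_minus field_simps)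
    qed
    then have "exp (- 2 * q) ^ card V \<le> (1 - q) ^ card V" by (intro power_mono) auto
    moreover have "exp (- 2 * q) ^ card V = exp (- (2 * q * card V))"
      by (simp flip: exp_of_nat_mult add: algebra_simps)
    ultimately have "exp (- (2 * q * card V)) \<le> exp (- (\<delta> * card T))" using 1 by linarith
    then have "\<delta> * card T \<le> 2 * q * card V" by simp
    then show ?thesis using T unfolding fingerprint_def by (intro exI[of _ T]) auto
  qed
  then show ?thesis by blast
qed

section \<open>Sets of vertices containing a clique inside a container\<close>

lemma card_nsets_eq: "finite A \<Longrightarrow> card ([A]\<^bsup>k\<^esup>) = card A choose k"
  unfolding nsets_def by (simp add: n_subsets finite_subset[of _ A] cong: conj_cong)

lemma sum_Pow_card:
  assumes "finite X"
  shows "(\<Sum>L\<in>Pow X. h (card L)) = (\<Sum>j\<le>card X. of_nat (card X choose j) * (h j :: real))"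
proof -
  have "(\<Sum>L\<in>Pow X. h (card L)) = (\<Sum>j\<le>card X. \<Sum>L\<in>{L\<in>Pow X. card L = j}. h (card L))"
    using assms by (intro sum.group[symmetric]) (auto simp: card_mono)
  also have "\<dots> = (\<Sum>j\<le>card X. of_nat (card X choose j) * h j)"
    using assms by (intro sum.cong refl) (simp add: n_subsets)
  finally show ?thesis .
qed

lemma binomial_diff_le:
  assumes "j \<le> R" "R \<le> N"
  shows "((N - j) choose (R - j)) * N ^ j \<le> R ^ j * (N choose R)"
  using assms(1)
proof (induction j)
  case (Suc j)
  have R: "R - j > 0" using Suc.prems by simp
  have eq: "(R - j) * ((N - j) choose (R - j)) = (N - j) * ((N - Suc j) choose (R - Suc j))"
    using times_binomial_minus1_eq[OF R, of "N - j"] by simp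
  have "N * (R - j) \<le> R * (N - j)"
    using assms(2) by (simp add: diff_mult_distrib2 diff_le_mono2 mult.commute)
  then have "(N - j) * (N * ((N - Suc j) choose (R - Suc j))) \<le> (N - j) * (R * ((N - j) choose (R - j)))"
    using mult_le_mono1[of "N * (R - j)" "R * (N - j)" "(N - j) choose (R - j)"]
    by (metis (no_types, opaque_lifting) eq mult.assoc mult.left_commute)
  then have 1: "N * ((N - Suc j) choose (R - Suc j)) \<le> R * ((N - j) choose (R - j))"
    using assms(2) R by simp
  have "((N - Suc j) choose (R - Suc j)) * N ^ Suc j = N * ((N - Suc j) choose (R - Suc j)) * N ^ j"
    by simp
  also have "\<dots> \<le> R * ((N - j) choose (R - j)) * N ^ j"
    using 1 by (rule mult_le_mono1)
  also have "\<dots> \<le> R * (R ^ j * (N choose R))"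
    using Suc by (simp add: mult.assoc)
  finally show ?case by simp
qed simp

lemma card_nsets_superset:
  assumes "finite W" "L \<subseteq> W" "card L \<le> R" "R \<le> card W"
  shows "card {Y\<in>[W]\<^bsup>R\<^esup>. L \<subseteq> Y} * card W ^ card L \<le> R ^ card L * (card W choose R)"
proof -
  have fin: "finite L" using assms by (auto intro: finite_subset)
  have "{Y\<in>[W]\<^bsup>R\<^esup>. L \<subseteq> Y} \<subseteq> (\<lambda>Z. Z \<union> L) ` (nsets (W - L) (R - card L))"
  proof
    fix Y assume "Y \<in> {Y\<in>[W]\<^bsup>R\<^esup>. L \<subseteq> Y}"
    then have "Y - L \<in> nsets (W - L) (R - card L)" "Y = (Y - L) \<union> L"
      using fin by (auto simp: nsets_def card_Diff_subset)
    then show "Y \<in> (\<lambda>Z. Z \<union> L) ` (nsets (W - L) (R - card L))" by blast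
  qed
  then have "card {Y\<in>[W]\<^bsup>R\<^esup>. L \<subseteq> Y} \<le> card (nsets (W - L) (R - card L))"
    using assms by (intro surj_card_le) (auto simp: finite_imp_finite_nsets)
  also have "\<dots> = (card W - card L) choose (R - card L)"
    using assms fin by (simp add: card_nsets_eq card_Diff_subset)
  finally show ?thesis
    using binomial_diff_le[OF assms(3,4)] by (meson le_trans mult_le_mono1)
qed

definition clique_free :: "nat \<Rightarrow> 'a set set \<Rightarrow> bool" where
  "clique_free n I \<longleftrightarrow> (\<forall>X. finite X \<and> card X = n \<longrightarrow> \<not> [X]\<^bsup>2\<^esup> \<subseteq> I)"

lemma clique_free_mono: "clique_free n B \<Longrightarrow> A \<subseteq> B \<Longrightarrow> clique_free n A"
  unfolding clique_free_def by blast

lemma choose_two_le_fact: "j choose 2 \<le> fact j"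
proof (cases "j < 2")
  case False
  then obtain i where "j = i + 2" by (metis add.commute le_Suc_ex linorder_not_less)
  have "j choose 2 \<le> (j choose 2) * (fact 2 * fact (j - 2))" by simp
  also have "\<dots> = fact j"
    using binomial_fact_lemma[of 2 j] False by (simp add: algebra_simps)
  finally show ?thesis .
qed (simp add: binomial_eq_0)

text \<open>Choose a clique \<open>X Y\<close> in each \<open>R\<close>-set \<open>Y\<close> that contains one and apply the second moment bound to these
  cliques. A clique shares a given set \<open>L\<close> of \<open>j\<close> vertices with another one only if \<open>L\<close> lies in the
  other \<open>R\<close>-set, which happens for a proportion of at most \<open>(R / N) ^ j\<close> of all \<open>R\<close>-sets. The lower bound on
  \<open>r\<close> makes the contribution of every \<open>j > 2\<close> no larger than the bound for single common edges. Writing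
  the probability as \<open>r\<^sup>2\<close> makes the exponents integral, since \<open>2 (j choose 2) = 2 + (j - 2) (j + 1)\<close>.\<close>
lemma few_sets_with_clique:
  fixes r \<delta> :: real
  assumes W: "finite W" "card W = N" and n: "n \<ge> 2" "n \<le> R" "R \<le> N"
    and r: "0 < r" "r < 1" "real n * real R / real N \<le> r ^ (n + 1)"
    and sat: "D \<subseteq> [W]\<^bsup>2\<^esup>" "saturated (r\<^sup>2) \<delta> (Collect (clique_free n)) D S" "clique_free n S"
    and "\<delta> > 0"
  shows "card {Y\<in>[W]\<^bsup>R\<^esup>. \<exists>X\<subseteq>Y. card X = n \<and> [X]\<^bsup>2\<^esup> \<subseteq> D} \<le> \<delta> * real n ^ 3 * real R ^ 2 / 2 * (N choose R)"
proof -
  define q where "q = r\<^sup>2"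
  define J where "J = {Y\<in>[W]\<^bsup>R\<^esup>. \<exists>X\<subseteq>Y. card X = n \<and> [X]\<^bsup>2\<^esup> \<subseteq> D}"
  define B where "B = real (N choose R)"
  define a where "a = real n * real R / real N"
  have q: "0 < q" "q < 1" using r by (auto simp: q_def power_less_one_iff)
  have N: "N > 0" using n by simp
  have a: "0 < a" using n N by (auto simp: a_def)
  have finJ: "finite J" using W by (simp add: J_def finite_imp_finite_nsets)
  have "\<forall>Y\<in>J. \<exists>X. X \<subseteq> Y \<and> card X = n \<and> [X]\<^bsup>2\<^esup> \<subseteq> D"
    by (auto simp: J_def)
  then obtain X where "\<forall>Y\<in>J. X Y \<subseteq> Y \<and> card (X Y) = n \<and> [X Y]\<^bsup>2\<^esup> \<subseteq> D"
    by (rule bchoice[THEN exE])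
  then have X: "X Y \<subseteq> Y" "card (X Y) = n" "[X Y]\<^bsup>2\<^esup> \<subseteq> D" if "Y \<in> J" for Y
    using that by auto
  have finX: "finite (X Y)" if "Y \<in> J" for Y
    using X(2)[OF that] n by (metis card.infinite not_numeral_le_zero)
  define h where "h j = real (j choose 2) / q ^ (j choose 2)" for j
  define s where "s = n choose 2"
  have h0: "h j \<ge> 0" for j using q by (simp add: h_def)
  have pair: "card ([X x]\<^bsup>2\<^esup> \<inter> [X y]\<^bsup>2\<^esup>) * q ^ card ([X x]\<^bsup>2\<^esup> \<union> [X y]\<^bsup>2\<^esup>)
      = q ^ (2 * s) * h (card (X x \<inter> X y))" if "x \<in> J" "y \<in> J" for x y
  proof -
    have "[X x]\<^bsup>2\<^esup> \<inter> [X y]\<^bsup>2\<^esup> = [X x \<inter> X y]\<^bsup>2\<^esup>" by (auto simp: nsets_def)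
    then have 1: "card ([X x]\<^bsup>2\<^esup> \<inter> [X y]\<^bsup>2\<^esup>) = card (X x \<inter> X y) choose 2"
      using finX that by (simp add: card_nsets_eq)
    have "card ([X x]\<^bsup>2\<^esup> \<union> [X y]\<^bsup>2\<^esup>) + card ([X x]\<^bsup>2\<^esup> \<inter> [X y]\<^bsup>2\<^esup>) = 2 * s"
      using card_Un_Int[of "[X x]\<^bsup>2\<^esup>" "[X y]\<^bsup>2\<^esup>"] finX that X(2)
      by (simp add: finite_imp_finite_nsets card_nsets_eq s_def)
    then have "q ^ card ([X x]\<^bsup>2\<^esup> \<union> [X y]\<^bsup>2\<^esup>) * q ^ (card (X x \<inter> X y) choose 2) = q ^ (2 * s)"
      by (simp add: 1 flip: power_add)
    then show ?thesis using q by (simp add: 1 h_def field_simps)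
  qed
  have level: "real (n choose j) * (h j * (real R / real N) ^ j) \<le> (if j < 2 then 0 else a\<^sup>2 / q)" if "j \<le> n" for j
  proof (cases "j < 2")
    case True
    then show ?thesis by (simp add: h_def binomial_eq_0)
  next
    case False
    then obtain i where i: "j = i + 2" by (metis add.commute le_Suc_ex linorder_not_less)
    have "2 * (j choose 2) = 2 + i * (i + 3)"
    proof -
      have "2 * (j choose 2) = j * (j - 1)" using times_binomial_minus1_eq[of 2 j] by simp
      then show ?thesis by (simp add: i algebra_simps)
    qed
    then have qj: "q ^ (j choose 2) = q * (r ^ (i + 3)) ^ i"
      by (simp add: q_def flip: power_mult power_add) (simp add: power_add power_mult mult.commute power2_eq_square)
    have "(n choose j) * (j choose 2) \<le> (n choose j) * fact j"
      by (intro mult_le_mono2 choose_two_le_fact)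
    also have "\<dots> \<le> n ^ j" by (rule binomial_fact_pow)
    finally have "real ((n choose j) * (j choose 2)) \<le> real (n ^ j)" by (intro of_nat_mono)
    then have "real ((n choose j) * (j choose 2)) * (real R / real N) ^ j \<le> real (n ^ j) * (real R / real N) ^ j"
      by (intro mult_right_mono) auto
    also have "\<dots> = a ^ j" by (simp add: a_def power_mult_distrib power_divide)
    also have "\<dots> = a\<^sup>2 * a ^ i" by (simp add: i power_add power2_eq_square)
    also have "\<dots> \<le> a\<^sup>2 * (r ^ (n + 1)) ^ i"
      using a r(3) by (intro mult_left_mono power_mono) (auto simp: a_def)
    also have "\<dots> \<le> a\<^sup>2 * (r ^ (i + 3)) ^ i"
      using r that i by (intro mult_left_mono power_mono power_decreasing) auto
    finally have "real ((n choose j) * (j choose 2)) * (real R / real N) ^ j / (q * (r ^ (i + 3)) ^ i)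
        \<le> a\<^sup>2 * (r ^ (i + 3)) ^ i / (q * (r ^ (i + 3)) ^ i)"
      using q r by (intro divide_right_mono) auto
    then show ?thesis
      using False q r by (simp add: h_def qj)
  qed
  \<comment> \<open>Each \<open>y\<close> is counted through the particular set \<open>L = X x \<inter> X y\<close>.\<close>
  have sum_h: "(\<Sum>y\<in>J. h (card (X x \<inter> X y))) \<le> B * (n * (a\<^sup>2 / q))" if x: "x \<in> J" for x
  proof -
    have "(\<Sum>y\<in>J. h (card (X x \<inter> X y))) \<le> (\<Sum>y\<in>J. \<Sum>L\<in>Pow (X x). of_bool (L \<subseteq> y) * h (card L))"
    proof (intro sum_mono)
      fix y assume y: "y \<in> J"
      have "of_bool (X x \<inter> X y \<subseteq> y) * h (card (X x \<inter> X y)) \<le> (\<Sum>L\<in>Pow (X x). of_bool (L \<subseteq> y) * h (card L))"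
        using finX[OF x] h0 by (intro member_le_sum) auto
      then show "h (card (X x \<inter> X y)) \<le> (\<Sum>L\<in>Pow (X x). of_bool (L \<subseteq> y) * h (card L))"
        using X(1)[OF y] by (simp add: le_infI2)
    qed
    also have "\<dots> = (\<Sum>L\<in>Pow (X x). \<Sum>y\<in>J. of_bool (L \<subseteq> y) * h (card L))" by (rule sum.swap)
    also have "\<dots> = (\<Sum>L\<in>Pow (X x). h (card L) * card {y\<in>J. L \<subseteq> y})"
      using finJ by (intro sum.cong refl) (simp flip: sum_distrib_right add: Int_def)
    also have "\<dots> \<le> (\<Sum>L\<in>Pow (X x). h (card L) * ((real R / real N) ^ card L * B))"
    proof (intro sum_mono mult_left_mono h0)
      fix L assume "L \<in> Pow (X x)"
      then have L: "L \<subseteq> X x" by simp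
      have "X x \<subseteq> W" using X(1)[OF x] x by (auto simp: J_def nsets_def)
      moreover have "card L \<le> R" using card_mono[OF finX[OF x] L] X(2)[OF x] n by simp
      ultimately have 1: "card {Y\<in>[W]\<^bsup>R\<^esup>. L \<subseteq> Y} * N ^ card L \<le> R ^ card L * (N choose R)"
        using card_nsets_superset[of W L R] W L n by auto
      have "card {y\<in>J. L \<subseteq> y} \<le> card {Y\<in>[W]\<^bsup>R\<^esup>. L \<subseteq> Y}"
        using W by (intro card_mono) (auto simp: J_def finite_imp_finite_nsets)
      then have "card {y\<in>J. L \<subseteq> y} * N ^ card L \<le> R ^ card L * (N choose R)"
        using 1 by (meson le_trans mult_le_mono1)
      then have "real (card {y\<in>J. L \<subseteq> y} * N ^ card L) \<le> real (R ^ card L * (N choose R))"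
        by (rule of_nat_mono)
      then show "real (card {y\<in>J. L \<subseteq> y}) \<le> (real R / real N) ^ card L * B"
        using N by (simp add: B_def power_divide field_simps)
    qed
    also have "\<dots> = B * (\<Sum>L\<in>Pow (X x). h (card L) * (real R / real N) ^ card L)"
      by (simp add: sum_distrib_left algebra_simps)
    also have "(\<Sum>L\<in>Pow (X x). h (card L) * (real R / real N) ^ card L)
        = (\<Sum>j\<le>n. real (n choose j) * (h j * (real R / real N) ^ j))"
      using sum_Pow_card[OF finX[OF x], of "\<lambda>j. h j * (real R / real N) ^ j"] X(2)[OF x] by simp
    also have "\<dots> \<le> (\<Sum>j\<le>n. if j < 2 then 0 else a\<^sup>2 / q)"
      by (intro sum_mono level) simp
    also have "\<dots> = (\<Sum>j\<in>{2..n}. a\<^sup>2 / q)"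
      by (intro sum.mono_neutral_cong_right) auto
    also have "\<dots> \<le> n * (a\<^sup>2 / q)"
      using q n by (simp add: field_simps)
    finally show ?thesis by (simp add: B_def mult_left_mono)
  qed
  have finD: "finite D" using sat(1) W by (auto intro: finite_subset simp: finite_imp_finite_nsets)
  have "(\<Sum>y\<in>J. q ^ card ([X y]\<^bsup>2\<^esup>))\<^sup>2 \<le> (\<delta> * q * card D) *
      (\<Sum>x\<in>J. \<Sum>y\<in>J. card ([X x]\<^bsup>2\<^esup> \<inter> [X y]\<^bsup>2\<^esup>) * q ^ card ([X x]\<^bsup>2\<^esup> \<union> [X y]\<^bsup>2\<^esup>))"
  proof (rule saturated_second_moment[OF finD _ q(2)])
    show "saturated q \<delta> (Collect (clique_free n)) D S" using sat(2) by (simp add: q_def)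
    show "[X y]\<^bsup>2\<^esup> \<notin> Collect (clique_free n)" if "y \<in> J" for y
      using finX[OF that] X(2)[OF that] by (auto simp: clique_free_def)
  qed (use q sat(3) finJ X(3) in \<open>auto intro: clique_free_mono\<close>)
  also have "(\<Sum>x\<in>J. \<Sum>y\<in>J. card ([X x]\<^bsup>2\<^esup> \<inter> [X y]\<^bsup>2\<^esup>) * q ^ card ([X x]\<^bsup>2\<^esup> \<union> [X y]\<^bsup>2\<^esup>))
      = q ^ (2 * s) * (\<Sum>x\<in>J. \<Sum>y\<in>J. h (card (X x \<inter> X y)))"
    unfolding sum_distrib_left by (intro sum.cong refl pair)
  also have "(\<Sum>y\<in>J. q ^ card ([X y]\<^bsup>2\<^esup>)) = (\<Sum>y\<in>J. q ^ s)"
    using finX X(2) by (intro sum.cong refl) (simp add: card_nsets_eq s_def)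
  also have "(\<Sum>y\<in>J. q ^ s)\<^sup>2 = q ^ (2 * s) * (real (card J))\<^sup>2"
    by (simp add: power_mult_distrib power_mult mult.commute power2_eq_square power_add)
  also have "(\<delta> * q * card D) * (q ^ (2 * s) * (\<Sum>x\<in>J. \<Sum>y\<in>J. h (card (X x \<inter> X y))))
      \<le> (\<delta> * q * card D) * (q ^ (2 * s) * (\<Sum>x\<in>J. B * (n * (a\<^sup>2 / q))))"
    using \<open>\<delta> > 0\<close> q by (intro mult_left_mono sum_mono sum_h) auto
  also have "\<dots> = q ^ (2 * s) * (card J * (\<delta> * card D * (B * n * a\<^sup>2)))"
    using q by (simp add: field_simps)
  finally have 1: "(real (card J))\<^sup>2 \<le> card J * (\<delta> * card D * (B * n * a\<^sup>2))"
    using q by simp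
  have "card D \<le> N choose 2"
    using card_mono[OF _ sat(1)] W by (simp add: card_nsets_eq finite_imp_finite_nsets)
  moreover have "2 * (N choose 2) \<le> N * N"
    using times_binomial_minus1_eq[of 2 N] by simp
  ultimately have "2 * card D \<le> N * N" by linarith
  then have D: "real (card D) \<le> real N ^ 2 / 2"
    by (simp add: power2_eq_square flip: of_nat_mult)
  have "real (card J) \<le> \<delta> * card D * (B * n * a\<^sup>2)"
  proof (cases "card J = 0")
    case True
    then show ?thesis using \<open>\<delta> > 0\<close> by (simp add: B_def)
  next
    case False
    then show ?thesis using 1 by (simp add: power2_eq_square)
  qed
  also have "\<dots> \<le> \<delta> * (real N ^ 2 / 2) * (B * n * a\<^sup>2)"
    using D \<open>\<delta> > 0\<close> by (intro mult_right_mono mult_left_mono) (auto simp: B_def)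
  also have "\<dots> = \<delta> * real n ^ 3 * real R ^ 2 / 2 * B"
    using N by (simp add: a_def field_simps power2_eq_square power3_eq_cube)
  finally show ?thesis by (simp add: J_def B_def)
qed

section \<open>Colourings without monochromatic cliques\<close>

definition clique_free_colourable :: "nat \<Rightarrow> nat \<Rightarrow> 'a set set \<Rightarrow> bool" where
  "clique_free_colourable n k G \<longleftrightarrow> (\<exists>c \<in> G \<rightarrow> {1..k}. \<forall>i\<in>{1..k}. clique_free n {e\<in>G. c e = i})"

lemma subset_if_nsets_2_subset:
  assumes "[X]\<^bsup>2\<^esup> \<subseteq> [W]\<^bsup>2\<^esup>" "card X \<ge> 2"
  shows "X \<subseteq> W"
proof
  fix x assume "x \<in> X"
  moreover have "X \<noteq> {x}" using assms(2) by auto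
  ultimately obtain y where "y \<in> X" "x \<noteq> y" by blast
  then have "{x, y} \<in> [X]\<^bsup>2\<^esup>" using \<open>x \<in> X\<close> by simp
  then have "{x, y} \<in> [W]\<^bsup>2\<^esup>" using assms(1) by (rule rev_subsetD)
  then show "x \<in> W" by simp
qed

lemma contains_complete_graph_iff:
  "contains_graph G (complete_graph n) \<longleftrightarrow>
     (\<exists>X\<subseteq>verts G. finite X \<and> card X = n \<and> [X]\<^bsup>2\<^esup> \<subseteq> edges G)"
proof
  assume "contains_graph G (complete_graph n)"
  then obtain f where f: "inj_on f {..<n}" "f ` {..<n} \<subseteq> verts G"
    "\<And>e. e \<in> [{..<n}]\<^bsup>2\<^esup> \<Longrightarrow> f ` e \<in> edges G"
    by (auto simp: contains_graph_def complete_graph_def)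
  have "[f ` {..<n}]\<^bsup>2\<^esup> \<subseteq> edges G"
  proof
    fix e assume "e \<in> [f ` {..<n}]\<^bsup>2\<^esup>"
    then obtain x y where "x \<in> {..<n}" "y \<in> {..<n}" "f x \<noteq> f y" "e = {f x, f y}"
      by (auto simp: nsets_2_eq)
    then show "e \<in> edges G" using f(3)[of "{x, y}"] by auto
  qed
  then show "\<exists>X\<subseteq>verts G. finite X \<and> card X = n \<and> [X]\<^bsup>2\<^esup> \<subseteq> edges G"
    using f by (intro exI[of _ "f ` {..<n}"]) (auto simp: card_image)
next
  assume "\<exists>X\<subseteq>verts G. finite X \<and> card X = n \<and> [X]\<^bsup>2\<^esup> \<subseteq> edges G"
  then obtain X where X: "X \<subseteq> verts G" "finite X" "card X = n" "[X]\<^bsup>2\<^esup> \<subseteq> edges G" by blast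
  then obtain f where f: "bij_betw f {..<n} X"
    using bij_betw_from_nat_into_finite ex_bij_betw_nat_finite by (metis atLeast0LessThan)
  have "f ` e \<in> edges G" if "e \<in> [{..<n}]\<^bsup>2\<^esup>" for e
    using that f X(4) bij_betw_nsets[OF f, of 2] by (auto simp: bij_betw_def)
  then show "contains_graph G (complete_graph n)"
    using f X unfolding contains_graph_def complete_graph_def
    by (intro exI[of _ f]) (auto simp: bij_betw_def)
qed

text \<open>For \<open>n \<ge> 2\<close> a clique is determined by its edges, so the vertex set of the graph can be forgotten.\<close>
lemma ramsey_arrow_iff:
  assumes "n \<ge> 2" "is_graph G"
  shows "ramsey_arrow G (complete_graph n) k \<longleftrightarrow> \<not> clique_free_colourable n k (edges G)"
proof -
  have "contains_graph (colour_class G c i) (complete_graph n) \<longleftrightarrow> \<not> clique_free n {e\<in>edges G. c e = i}" for c i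
  proof -
    have "X \<subseteq> verts G" if "card X = n" "[X]\<^bsup>2\<^esup> \<subseteq> {e\<in>edges G. c e = i}" for X
      by (rule subset_if_nsets_2_subset) (use that assms in \<open>auto simp: is_graph_def\<close>)
    then show ?thesis
      unfolding contains_complete_graph_iff clique_free_def colour_class_def fst_conv snd_conv by blast
  qed
  then show ?thesis by (simp add: ramsey_arrow_def clique_free_colourable_def)
qed

lemma clique_free_colourable_transfer:
  assumes "inj_on h W" "G \<subseteq> [W]\<^bsup>2\<^esup>" "clique_free_colourable n k H" "\<And>e. e \<in> G \<Longrightarrow> h ` e \<in> H" "n \<ge> 2"
  shows "clique_free_colourable n k G"
proof -
  obtain c where c: "c \<in> H \<rightarrow> {1..k}" "\<And>i. i \<in> {1..k} \<Longrightarrow> clique_free n {e\<in>H. c e = i}"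
    using assms(3) by (auto simp: clique_free_colourable_def)
  have "clique_free n {e\<in>G. c (h ` e) = i}" if "i \<in> {1..k}" for i
    unfolding clique_free_def
  proof (intro allI impI notI)
    fix X assume X: "finite X \<and> card X = n" "[X]\<^bsup>2\<^esup> \<subseteq> {e\<in>G. c (h ` e) = i}"
    have "X \<subseteq> W"
      by (rule subset_if_nsets_2_subset) (use X assms(2,5) in auto)
    have "[h ` X]\<^bsup>2\<^esup> \<subseteq> {e\<in>H. c e = i}"
    proof
      fix e assume "e \<in> [h ` X]\<^bsup>2\<^esup>"
      then obtain x y where xy: "x \<in> X" "y \<in> X" "x \<noteq> y" "e = h ` {x, y}"
        by (auto simp: nsets_2_eq)
      then have "{x, y} \<in> [X]\<^bsup>2\<^esup>" by simp
      then have "{x, y} \<in> {e\<in>G. c (h ` e) = i}" using X(2) by (rule rev_subsetD)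
      then show "e \<in> {e\<in>H. c e = i}" using assms(4)[of "{x, y}"] xy(4) by auto
    qed
    moreover have "card (h ` X) = n"
      using X(1) inj_on_subset[OF assms(1) \<open>X \<subseteq> W\<close>] by (simp add: card_image)
    ultimately show False using c(2)[OF that] X(1) unfolding clique_free_def by blast
  qed
  then show ?thesis
    unfolding clique_free_colourable_def using c(1) assms(4)
    by (intro bexI[of _ "\<lambda>e. c (h ` e)"]) auto
qed

lemma not_clique_free_colourable_nsets:
  assumes "finite Y" "card Y = R" "n \<ge> 2" "\<not> clique_free_colourable n k ([{..<R}]\<^bsup>2\<^esup>)"
  shows "\<not> clique_free_colourable n k ([Y]\<^bsup>2\<^esup>)"
proof
  assume "clique_free_colourable n k ([Y]\<^bsup>2\<^esup>)"
  obtain h where h: "bij_betw h {..<R} Y"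
    using assms(1,2) ex_bij_betw_nat_finite by (metis atLeast0LessThan)
  have "clique_free_colourable n k ([{..<R}]\<^bsup>2\<^esup>)"
    using bij_betw_nsets[OF h, of 2] h
    by (intro clique_free_colourable_transfer[OF _ subset_refl \<open>clique_free_colourable n k ([Y]\<^bsup>2\<^esup>)\<close> _ assms(3)])
      (auto simp: bij_betw_def)
  then show False using assms(4) by simp
qed

text \<open>A cover of the edges of \<open>Y\<close> by \<open>k\<close> sets is turned into a colouring by choosing for each edge one of the
  sets containing it.\<close>
lemma clique_in_cover:
  assumes "\<not> clique_free_colourable n k ([Y]\<^bsup>2\<^esup>)" "[Y]\<^bsup>2\<^esup> \<subseteq> (\<Union>i\<in>{1..k}. D i)" "n \<ge> 2"
  obtains i X where "i \<in> {1..k}" "X \<subseteq> Y" "card X = n" "[X]\<^bsup>2\<^esup> \<subseteq> D i"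
proof -
  have "\<forall>e\<in>[Y]\<^bsup>2\<^esup>. \<exists>i. i \<in> {1..k} \<and> e \<in> D i" using assms(2) by blast
  then obtain c where c: "\<forall>e\<in>[Y]\<^bsup>2\<^esup>. c e \<in> {1..k} \<and> e \<in> D (c e)"
    by (rule bchoice[THEN exE])
  then have "c \<in> [Y]\<^bsup>2\<^esup> \<rightarrow> {1..k}" by auto
  then obtain i where i: "i \<in> {1..k}" "\<not> clique_free n {e\<in>[Y]\<^bsup>2\<^esup>. c e = i}"
    using assms(1) by (auto simp: clique_free_colourable_def)
  then obtain X where X: "finite X" "card X = n" "[X]\<^bsup>2\<^esup> \<subseteq> {e\<in>[Y]\<^bsup>2\<^esup>. c e = i}"
    by (auto simp: clique_free_def)
  have "X \<subseteq> Y"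
    by (rule subset_if_nsets_2_subset) (use X assms(3) in auto)
  moreover have "[X]\<^bsup>2\<^esup> \<subseteq> D i" using X(3) c by auto
  ultimately show thesis using that i(1) X(2) by blast
qed

text \<open>An \<open>R\<close>-set all of whose edges are covered contains a clique inside some \<open>D i\<close>, which by assumption
  happens for at most a quarter of all \<open>R\<close>-sets. The other \<open>R\<close>-sets contain a missing edge, and each
  missing edge lies in a proportion of at most \<open>(R / N)\<^sup>2\<close> of the \<open>R\<close>-sets.\<close>
lemma many_missing_edges:
  assumes W: "finite W" "card W = N" "2 \<le> R" "R \<le> N" and n: "n \<ge> 2" and k: "k \<ge> 1"
    and ram: "\<not> clique_free_colourable n k ([{..<R}]\<^bsup>2\<^esup>)"
    and few: "\<And>i. i \<in> {1..k} \<Longrightarrow>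
      real (card {Y\<in>[W]\<^bsup>R\<^esup>. \<exists>X\<subseteq>Y. card X = n \<and> [X]\<^bsup>2\<^esup> \<subseteq> D i}) \<le> (N choose R) / (4 * real k)"
  shows "3 / 4 * (real N / real R)\<^sup>2 \<le> card ([W]\<^bsup>2\<^esup> - (\<Union>i\<in>{1..k}. D i))"
proof -
  define M where "M = [W]\<^bsup>2\<^esup> - (\<Union>i\<in>{1..k}. D i)"
  define B where "B = real (N choose R)"
  let ?J = "\<lambda>i. {Y\<in>[W]\<^bsup>R\<^esup>. \<exists>X\<subseteq>Y. card X = n \<and> [X]\<^bsup>2\<^esup> \<subseteq> D i}"
  let ?E = "\<lambda>e. {Y\<in>[W]\<^bsup>R\<^esup>. e \<subseteq> Y}"
  have fin: "finite ([W]\<^bsup>R\<^esup>)" "finite M" using W by (auto simp: M_def finite_imp_finite_nsets)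
  have B: "B > 0" using W by (simp add: B_def)
  have "[W]\<^bsup>R\<^esup> \<subseteq> (\<Union>i\<in>{1..k}. ?J i) \<union> (\<Union>e\<in>M. ?E e)"
  proof
    fix Y assume Y: "Y \<in> [W]\<^bsup>R\<^esup>"
    show "Y \<in> (\<Union>i\<in>{1..k}. ?J i) \<union> (\<Union>e\<in>M. ?E e)"
    proof (cases "[Y]\<^bsup>2\<^esup> \<subseteq> (\<Union>i\<in>{1..k}. D i)")
      case True
      have "\<not> clique_free_colourable n k ([Y]\<^bsup>2\<^esup>)"
        using Y by (intro not_clique_free_colourable_nsets[OF _ _ n ram]) (simp_all add: nsets_def)
      then obtain i X where "i \<in> {1..k}" "X \<subseteq> Y" "card X = n" "[X]\<^bsup>2\<^esup> \<subseteq> D i"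
        by (rule clique_in_cover[OF _ True n])
      then have "Y \<in> ?J i" using Y by auto
      then show ?thesis using \<open>i \<in> {1..k}\<close> by blast
    next
      case False
      then obtain e where "e \<in> [Y]\<^bsup>2\<^esup>" "e \<notin> (\<Union>i\<in>{1..k}. D i)" by blast
      then have "e \<in> M" "e \<subseteq> Y" using Y by (auto simp: M_def nsets_def)
      then have "Y \<in> ?E e" using Y by auto
      then show ?thesis using \<open>e \<in> M\<close> by blast
    qed
  qed
  then have "card ([W]\<^bsup>R\<^esup>) \<le> card ((\<Union>i\<in>{1..k}. ?J i) \<union> (\<Union>e\<in>M. ?E e))"
    using fin by (intro card_mono) auto
  also have "\<dots> \<le> (\<Sum>i\<in>{1..k}. card (?J i)) + (\<Sum>e\<in>M. card (?E e))"
    using fin by (intro order_trans[OF card_Un_le] add_mono card_UN_le) simp_all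
  finally have "real (N choose R) \<le> real ((\<Sum>i\<in>{1..k}. card (?J i)) + (\<Sum>e\<in>M. card (?E e)))"
    using W by (subst of_nat_le_iff) (simp add: card_nsets_eq)
  then have "B \<le> (\<Sum>i\<in>{1..k}. real (card (?J i))) + (\<Sum>e\<in>M. real (card (?E e)))"
    by (simp add: B_def)
  also have "\<dots> \<le> (\<Sum>i\<in>{1..k}. B / (4 * real k)) + (\<Sum>e\<in>M. (real R / real N)\<^sup>2 * B)"
  proof (intro add_mono sum_mono)
    fix i assume "i \<in> {1..k}"
    then show "real (card (?J i)) \<le> B / (4 * real k)" unfolding B_def by (rule few)
  next
    fix e assume "e \<in> M"
    then have e: "e \<subseteq> W" "card e = 2" by (auto simp: M_def nsets_def)
    have "card (?E e) * N\<^sup>2 \<le> R ^ 2 * (N choose R)"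
      using card_nsets_superset[of W e R] W e by simp
    then have "real (card (?E e) * N\<^sup>2) \<le> real (R\<^sup>2 * (N choose R))" by (rule of_nat_mono)
    then show "real (card (?E e)) \<le> (real R / real N)\<^sup>2 * B"
      using W by (simp add: B_def power_divide field_simps)
  qed
  also have "\<dots> = B / 4 + card M * ((real R / real N)\<^sup>2 * B)" using k by simp
  finally have "3 / 4 * B \<le> (card M * (real R / real N)\<^sup>2) * B" by simp
  then have "3 / 4 \<le> card M * (real R / real N)\<^sup>2" using B by (rule mult_right_le_imp_le)
  then have "3 / 4 * (real N / real R)\<^sup>2 \<le> card M * (real R / real N)\<^sup>2 * (real N / real R)\<^sup>2"
    by (rule mult_right_mono) simp
  also have "\<dots> = card M * (R / N * (real N / real R))\<^sup>2"
    by (simp only: power_mult_distrib mult.assoc)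
  also have "\<dots> = card M" using W by simp
  finally show ?thesis by (simp add: M_def)
qed

lemma card_small_subsets:
  assumes "finite V"
  shows "card {T. T \<subseteq> V \<and> card T \<le> t} \<le> (card V + 1) ^ t"
proof -
  have "{T. T \<subseteq> V \<and> card T \<le> t} = (\<Union>i\<le>t. {T. T \<subseteq> V \<and> card T = i})" by auto
  then have "card {T. T \<subseteq> V \<and> card T \<le> t} \<le> (\<Sum>i\<le>t. card {T. T \<subseteq> V \<and> card T = i})"
    by (simp add: card_UN_le)
  also have "\<dots> = (\<Sum>i\<le>t. card V choose i)" using assms by (simp add: n_subsets)
  also have "\<dots> \<le> (\<Sum>i\<le>t. (t choose i) * card V ^ i)"
  proof (intro sum_mono)
    fix i assume "i \<in> {..t}"
    then have "1 \<le> t choose i" by (simp add: Suc_leI)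
    moreover have "card V choose i \<le> card V ^ i"
      using binomial_fact_pow[of "card V" i] fact_ge_1[of i] by (metis mult.right_neutral mult_le_mono2 le_trans)
    ultimately show "card V choose i \<le> (t choose i) * card V ^ i"
      using mult_le_mono[of 1 "t choose i"] by simp
  qed
  also have "\<dots> = (card V + 1) ^ t" using binomial_ring[of "card V" 1 t] by simp
  finally show ?thesis .
qed

text \<open>Each colour class has a fingerprint \<open>T i\<close> and a container \<open>g (T i)\<close>. The union of all of these contains
  the graph and is determined by the \<open>k\<close> fingerprints, so there are few such unions. With the choice
  of \<open>\<delta>\<close> below, a single container accounts for at most a proportion \<open>1 / (4 k)\<close> of the \<open>R\<close>-sets; the
  fingerprints themselves are too small to fill the missing edges.\<close>
lemma colourable_container_family:
  fixes r t :: real and n k R N :: nat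
  assumes W: "finite W" "card W = N" and n: "3 \<le> n" "n \<le> R" "R \<le> N" and k: "k \<ge> 1"
    and ram: "\<not> clique_free_colourable n k ([{..<R}]\<^bsup>2\<^esup>)"
    and r: "0 < r" "real n * real R / real N \<le> r ^ (n + 1)" "8 * real k ^ 2 * real n ^ 3 * real R ^ 4 * r\<^sup>2 \<le> 1"
    and t: "2 * real k * real n ^ 3 * real R ^ 2 * r\<^sup>2 * real N ^ 2 \<le> t"
  obtains \<F> where "finite \<F>" "card \<F> \<le> ((N choose 2) + 1) ^ (nat \<lfloor>t\<rfloor> * k)"
    "\<And>F. F \<in> \<F> \<Longrightarrow> (real N / real R)\<^sup>2 / 2 \<le> card ([W]\<^bsup>2\<^esup> - F)"
    "\<And>G. G \<subseteq> [W]\<^bsup>2\<^esup> \<Longrightarrow> clique_free_colourable n k G \<Longrightarrow> \<exists>F\<in>\<F>. G \<subseteq> F"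
proof -
  define V where "V = [W]\<^bsup>2\<^esup>"
  define q where "q = r\<^sup>2"
  define \<delta> where "\<delta> = 1 / (2 * real k * real n ^ 3 * real R ^ 2)"
  define \<I> where "\<I> = Collect (clique_free n :: 'a set set \<Rightarrow> bool)"
  have finV: "finite V" and cardV: "card V = N choose 2"
    using W by (auto simp: V_def finite_imp_finite_nsets card_nsets_eq)
  have "2 * (N choose 2) \<le> N * N"
    using times_binomial_minus1_eq[of 2 N] by simp
  then have m: "2 * card V \<le> real N ^ 2"
    unfolding cardV power2_eq_square by (metis of_nat_le_iff of_nat_mult of_nat_numeral)
  have pos: "0 < real k" "0 < real n" "0 < real R" "0 < real N" using n k by auto
  have k1: "1 \<le> real k" "3 \<le> real n" "3 \<le> real R" using n k by auto
  have big: "1 < 2 * real k * real n ^ 3 * real R ^ 2"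
  proof -
    have "27 \<le> real n ^ 3" using power_mono[of 3 "real n" 3] k1 by simp
    then have "1 * 27 * 1 \<le> real k * real n ^ 3 * real R ^ 2"
      using k1 by (intro mult_mono one_le_power) auto
    then have "1 < 2 * real k * real n ^ 3 * real R ^ 2" by linarith
    then show ?thesis by simp
  qed
  have \<delta>: "0 < \<delta>" "\<delta> < 1"
    unfolding \<delta>_def using big by (simp_all only: zero_less_divide_1_iff divide_less_eq_1_pos less_trans[OF zero_less_one])
  have "1 * 1 * 1 \<le> real k ^ 2 * real n ^ 3 * real R ^ 4"
    using k1 by (intro mult_mono one_le_power) auto
  then have "8 \<le> 8 * real k ^ 2 * real n ^ 3 * real R ^ 4" by simp
  then have "8 * q \<le> 8 * real k ^ 2 * real n ^ 3 * real R ^ 4 * q"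
    by (rule mult_right_mono) (simp add: q_def)
  then have "8 * q \<le> 1"
    unfolding q_def by (rule order_trans) (rule r(3))
  then have q: "0 < q" "q \<le> 1 / 8" using r(1) by (simp_all add: q_def)
  have "r < 1"
  proof (rule ccontr)
    assume "\<not> r < 1"
    then have "1 \<le> r\<^sup>2" by (simp add: one_le_power)
    then show False using q(2) by (simp add: q_def)
  qed
  have "\<exists>g. \<forall>I\<in>\<I>. I \<subseteq> V \<longrightarrow> (\<exists>T. T \<subseteq> V \<and> \<delta> * card T \<le> 2 * q * card V \<and> T \<in> \<I> \<and>
      I \<subseteq> T \<union> g T \<and> g T \<subseteq> V \<and> saturated q \<delta> \<I> (g T) T)"
  proof (rule containers[OF finV q(1) _ \<delta>])
    show "A \<in> \<I>" if "B \<in> \<I>" "A \<subseteq> B" for A B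
      using that clique_free_mono unfolding \<I>_def by blast
  qed (use q in simp)
  then obtain g where g: "\<forall>I\<in>\<I>. I \<subseteq> V \<longrightarrow> (\<exists>T. T \<subseteq> V \<and> \<delta> * card T \<le> 2 * q * card V \<and> T \<in> \<I> \<and>
      I \<subseteq> T \<union> g T \<and> g T \<subseteq> V \<and> saturated q \<delta> \<I> (g T) T)" ..
  define \<T> where "\<T> = {T. T \<subseteq> V \<and> \<delta> * card T \<le> 2 * q * card V \<and> T \<in> \<I> \<and> g T \<subseteq> V \<and> saturated q \<delta> \<I> (g T) T}"
  define U where "U T = (\<Union>i\<in>{1..k}. T i) \<union> (\<Union>i\<in>{1..k}. g (T i))" for T :: "nat \<Rightarrow> 'a set set"
  define \<F> where "\<F> = U ` PiE {1..k} (\<lambda>_. \<T>)"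
  have small: "card T \<le> 2 * real k * real n ^ 3 * real R ^ 2 * q * real N ^ 2" if "T \<in> \<T>" for T
  proof -
    have "\<delta> * card T \<le> q * (2 * card V)" using that by (simp add: \<T>_def)
    also have "\<dots> \<le> q * real N ^ 2" using m q by (intro mult_left_mono) auto
    finally show ?thesis
      using pos by (simp add: \<delta>_def pos_divide_le_eq mult.commute mult.left_commute)
  qed
  have \<T>_sub: "\<T> \<subseteq> {T. T \<subseteq> V \<and> card T \<le> nat \<lfloor>t\<rfloor>}"
  proof
    fix T assume T: "T \<in> \<T>"
    have "real (card T) \<le> t"
      using small[OF T] t unfolding q_def by (rule order_trans)
    then have "card T \<le> nat \<lfloor>t\<rfloor>" by (rule le_nat_floor)
    then show "T \<in> {T. T \<subseteq> V \<and> card T \<le> nat \<lfloor>t\<rfloor>}" using T by (simp add: \<T>_def)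
  qed
  have fin\<T>: "finite \<T>" using finV by (simp add: \<T>_def)
  have "card \<T> \<le> ((N choose 2) + 1) ^ nat \<lfloor>t\<rfloor>"
    using card_mono[OF _ \<T>_sub] card_small_subsets[OF finV, of "nat \<lfloor>t\<rfloor>"] finV cardV by simp
  then have "card \<T> ^ k \<le> (((N choose 2) + 1) ^ nat \<lfloor>t\<rfloor>) ^ k" by (rule power_mono) simp
  moreover have "card \<F> \<le> card \<T> ^ k"
    unfolding \<F>_def using fin\<T> by (intro order_trans[OF card_image_le]) (auto simp: finite_PiE card_PiE)
  ultimately have card\<F>: "card \<F> \<le> ((N choose 2) + 1) ^ (nat \<lfloor>t\<rfloor> * k)"
    by (simp add: power_mult)
  have missing: "(real N / real R)\<^sup>2 / 2 \<le> card (V - F)" if "F \<in> \<F>" for F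
  proof -
    obtain T where T: "\<And>i. i \<in> {1..k} \<Longrightarrow> T i \<in> \<T>" and F: "F = U T"
      using \<open>F \<in> \<F>\<close> unfolding \<F>_def by (auto simp: PiE_def Pi_def)
    have finT: "finite (T i)" if "i \<in> {1..k}" for i
      using T[OF that] finV by (auto simp: \<T>_def intro: finite_subset)
    have "3 / 4 * (real N / real R)\<^sup>2 \<le> card (V - (\<Union>i\<in>{1..k}. g (T i)))"
      unfolding V_def
    proof (rule many_missing_edges[OF W _ n(3) _ k ram])
      fix i assume i: "i \<in> {1..k}"
      have "card {Y\<in>[W]\<^bsup>R\<^esup>. \<exists>X\<subseteq>Y. card X = n \<and> [X]\<^bsup>2\<^esup> \<subseteq> g (T i)} \<le> \<delta> * real n ^ 3 * real R ^ 2 / 2 * (N choose R)"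
        using T[OF i] r \<open>r < 1\<close> \<delta> n unfolding \<T>_def V_def \<I>_def q_def
        by (intro few_sets_with_clique[OF W _ n(2,3), where S = "T i"]) auto
      also have "\<delta> * real n ^ 3 * real R ^ 2 / 2 = 1 / (4 * k)"
        using pos by (simp add: \<delta>_def)
      finally show "card {Y\<in>[W]\<^bsup>R\<^esup>. \<exists>X\<subseteq>Y. card X = n \<and> [X]\<^bsup>2\<^esup> \<subseteq> g (T i)} \<le> (N choose R) / (4 * real k)"
        by simp
    qed (use n in auto)
    also have "\<dots> \<le> card ((V - F) \<union> (\<Union>i\<in>{1..k}. T i))"
      using finV finT by (intro of_nat_mono card_mono) (auto simp: F U_def)
    also have "\<dots> \<le> real (card (V - F) + (\<Sum>i\<in>{1..k}. card (T i)))"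
      by (intro of_nat_mono order_trans[OF card_Un_le] add_mono card_UN_le) simp_all
    also have "\<dots> = card (V - F) + (\<Sum>i\<in>{1..k}. real (card (T i)))" by simp
    also have "\<dots> \<le> card (V - F) + (\<Sum>i\<in>{1..k}. 2 * real k * real n ^ 3 * real R ^ 2 * q * real N ^ 2)"
      by (intro add_left_mono sum_mono small T)
    also have "\<dots> = card (V - F) + (8 * real k ^ 2 * real n ^ 3 * real R ^ 4 * q) * ((real N / real R)\<^sup>2 / 4)"
    proof -
      have "real R ^ 4 * (real N / real R)\<^sup>2 = real R ^ 2 * real N ^ 2"
        using pos by (simp add: power_divide eval_nat_numeral)
      moreover have "(8 * real k ^ 2 * real n ^ 3 * real R ^ 4 * q) * (D / 4)
          = 2 * real k ^ 2 * real n ^ 3 * q * (real R ^ 4 * D)" for D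
        by (simp only: mult_ac times_divide_eq_right times_divide_eq_left)
      moreover have "(\<Sum>i\<in>{1..k}. 2 * real k * real n ^ 3 * real R ^ 2 * q * real N ^ 2)
          = real k * (2 * real k * real n ^ 3 * real R ^ 2 * q * real N ^ 2)"
        by simp
      moreover have "\<dots> = 2 * real k ^ 2 * real n ^ 3 * q * (real R ^ 2 * real N ^ 2)"
        by algebra
      ultimately show ?thesis by (simp only:)
    qed
    also have "\<dots> \<le> card (V - F) + 1 * ((real N / real R)\<^sup>2 / 4)"
      unfolding q_def by (intro add_left_mono mult_right_mono r(3)) simp
    finally show ?thesis by linarith
  qed
  have cover: "\<exists>F\<in>\<F>. G \<subseteq> F" if G: "G \<subseteq> V" "clique_free_colourable n k G" for G
  proof -
    obtain c where c: "c \<in> G \<rightarrow> {1..k}" "\<And>i. i \<in> {1..k} \<Longrightarrow> clique_free n {e\<in>G. c e = i}"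
      using G(2) by (auto simp: clique_free_colourable_def)
    have "\<forall>i\<in>{1..k}. \<exists>T. T \<in> \<T> \<and> {e\<in>G. c e = i} \<subseteq> T \<union> g T"
    proof
      fix i assume "i \<in> {1..k}"
      then have "{e\<in>G. c e = i} \<in> \<I>" "{e\<in>G. c e = i} \<subseteq> V"
        using c(2) G(1) by (auto simp: \<I>_def)
      then obtain T where "T \<subseteq> V \<and> \<delta> * card T \<le> 2 * q * card V \<and> T \<in> \<I> \<and>
          {e\<in>G. c e = i} \<subseteq> T \<union> g T \<and> g T \<subseteq> V \<and> saturated q \<delta> \<I> (g T) T"
        using g by meson
      then show "\<exists>T. T \<in> \<T> \<and> {e\<in>G. c e = i} \<subseteq> T \<union> g T"
        unfolding \<T>_def by (intro exI[of _ T]) simp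
    qed
    then obtain T where T: "\<forall>i\<in>{1..k}. T i \<in> \<T> \<and> {e\<in>G. c e = i} \<subseteq> T i \<union> g (T i)"
      by (rule bchoice[THEN exE])
    have "G \<subseteq> U (restrict T {1..k})"
    proof
      fix e assume "e \<in> G"
      then have ce: "c e \<in> {1..k}" using funcset_mem[OF c(1)] by simp
      then have "e \<in> T (c e) \<union> g (T (c e))" using bspec[OF T ce] \<open>e \<in> G\<close> by blast
      then show "e \<in> U (restrict T {1..k})" using ce unfolding U_def by (auto simp del: atLeastAtMost_iff)
    qed
    moreover have "restrict T {1..k} \<in> PiE {1..k} (\<lambda>_. \<T>)"
      using T by (intro restrict_PiE_iff[THEN iffD2]) simp
    ultimately show ?thesis unfolding \<F>_def by blast
  qed
  show thesis
    using that[of \<F>] card\<F> missing cover fin\<T> unfolding V_def[symmetric]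
    by (simp add: \<F>_def finite_PiE)
qed

section \<open>A random graph outside all containers\<close>

lemma bmean_half_power_diff:
  assumes "finite V"
  shows "bmean p V (\<lambda>A. (1 / 2) ^ card (A - F)) = (1 - p / 2) ^ card (V - F)"
proof -
  have "bmean p V (\<lambda>A. (1 / 2) ^ card (A - F)) = bmean p V (\<lambda>A. \<Prod>v\<in>A. if v \<in> F then 1 else 1 / 2)"
  proof (intro bmean_cong)
    fix A assume "A \<subseteq> V"
    then have "finite A" using assms by (rule finite_subset)
    then show "(1 / 2) ^ card (A - F) = (\<Prod>v\<in>A. if v \<in> F then 1 else 1 / 2 :: real)"
      by (simp add: prod.If_cases Diff_eq)
  qed
  also have "\<dots> = (\<Prod>v\<in>V. if v \<in> F then 1 else 1 - p / 2)"
    using assms by (subst bmean_prod) (auto intro!: prod.cong)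
  also have "\<dots> = (1 - p / 2) ^ card (V - F)"
    using assms by (simp add: prod.If_cases Diff_eq)
  finally show ?thesis .
qed

text \<open>The function \<open>Z\<close> adds up the penalties for the two ways in which a random set \<open>A\<close> can fail: containing
  too many members of \<open>\<Q>\<close>, or having at most \<open>b\<close> elements outside some \<open>F \<in> \<F>\<close>. The factor \<open>exp b\<close> exceeds
  \<open>2 powr b\<close>, so either failure alone makes \<open>Z A\<close> at least \<open>1\<close>, while the mean of \<open>Z\<close> is smaller than \<open>1\<close>.
  For a set \<open>A\<close> that avoids both, removing one element from each member of \<open>\<Q>\<close> inside \<open>A\<close> removes fewer
  than \<open>b\<close> elements.\<close>
lemma random_subset_deletion:
  fixes p b :: real
  assumes V: "finite V" and p: "0 \<le> p" "p \<le> 1"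
    and Q: "finite \<Q>" "\<And>Q. Q \<in> \<Q> \<Longrightarrow> Q \<subseteq> V" "\<And>Q. Q \<in> \<Q> \<Longrightarrow> card Q = s" "s > 0" "2 * card \<Q> * p ^ s \<le> b"
    and F: "finite \<F>" "\<And>F. F \<in> \<F> \<Longrightarrow> 8 * b \<le> p * card (V - F)" "card \<F> \<le> exp (2 * b)" "b \<ge> 2"
  shows "\<exists>G\<subseteq>V. (\<forall>Q\<in>\<Q>. \<not> Q \<subseteq> G) \<and> (\<forall>F\<in>\<F>. \<not> G \<subseteq> F)"
proof -
  define Z where "Z A = (1 / b) * (\<Sum>Q\<in>\<Q>. of_bool (Q \<subseteq> A)) + exp b * (\<Sum>F\<in>\<F>. (1 / 2) ^ card (A - F))" for A
  have "bmean p V Z = card \<Q> * p ^ s / b + exp b * (\<Sum>F\<in>\<F>. (1 - p / 2) ^ card (V - F))"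
    unfolding Z_def bmean_add bmean_cmult bmean_sum bmean_half_power_diff[OF V]
    using bmean_superset[OF V Q(2)] Q(3) by simp
  also have "\<dots> \<le> 1 / 2 + exp b * (\<Sum>F\<in>\<F>. exp (- 4 * b))"
  proof (intro add_mono mult_left_mono sum_mono)
    fix F assume "F \<in> \<F>"
    have "(1 - p / 2) ^ card (V - F) \<le> exp (- p / 2) ^ card (V - F)"
      using p exp_ge_add_one_self[of "- p / 2"] by (intro power_mono) auto
    also have "\<dots> = exp (- (p * card (V - F)) / 2)"
      by (simp flip: exp_of_nat_mult add: algebra_simps)
    also have "\<dots> \<le> exp (- 4 * b)" using F(2)[OF \<open>F \<in> \<F>\<close>] by simp
    finally show "(1 - p / 2) ^ card (V - F) \<le> exp (- 4 * b)" .
  qed (use Q(5) F(4) in \<open>auto simp: field_simps\<close>)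
  also have "\<dots> \<le> 1 / 2 + exp b * (exp (2 * b) * exp (- 4 * b))"
    using F(3) by simp
  also have "\<dots> = 1 / 2 + exp (- b)"
    by (simp flip: exp_add)
  also have "\<dots> < 1 / 2 + 1 / 2"
  proof -
    have "1 + b \<le> exp b" by (rule exp_ge_add_one_self)
    then have "2 < exp b" using F(4) by linarith
    then show ?thesis by (simp add: exp_minus field_simps)
  qed
  finally have mean: "bmean p V Z < 1" by simp
  have "\<exists>A\<subseteq>V. Z A < 1"
  proof (rule ccontr)
    assume "\<not> (\<exists>A\<subseteq>V. Z A < 1)"
    then have "bmean p V (\<lambda>_. 1) \<le> bmean p V Z" using p by (intro bmean_mono) (auto simp: not_less)
    then show False using mean V by (simp add: bmean_const)
  qed
  then obtain A where A: "A \<subseteq> V" "Z A < 1" by blast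
  have finA: "finite A" using A(1) V by (rule finite_subset)
  define H where "H = {Q\<in>\<Q>. Q \<subseteq> A}"
  have "real (card H) < b"
  proof -
    have "(1 / b) * (\<Sum>Q\<in>\<Q>. of_bool (Q \<subseteq> A)) \<le> Z A"
      unfolding Z_def by (simp add: sum_nonneg)
    then have "(1 / b) * card H < 1" using A(2) Q(1) by (simp add: H_def Int_def)
    then show ?thesis using F(4) by (simp add: field_simps)
  qed
  have large: "b < card (A - F)" if "F \<in> \<F>" for F
  proof -
    have "(1 / 2) ^ card (A - F) \<le> (\<Sum>F\<in>\<F>. (1 / 2 :: real) ^ card (A - F))"
      using F(1) that by (intro member_le_sum) auto
    then have "exp b * (1 / 2) ^ card (A - F) \<le> exp b * (\<Sum>F\<in>\<F>. (1 / 2) ^ card (A - F))"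
      by simp
    also have "\<dots> \<le> Z A" unfolding Z_def using F(4) by (simp add: sum_nonneg)
    finally have "exp b * (1 / 2) ^ card (A - F) < 1" using A(2) by simp
    then have "exp b < 2 ^ card (A - F)" by (simp add: power_one_over field_simps)
    also have "\<dots> \<le> exp 1 ^ card (A - F)"
      using exp_ge_add_one_self[of 1] by (intro power_mono) auto
    also have "\<dots> = exp (card (A - F))" by (simp flip: exp_of_nat_mult)
    finally show ?thesis by simp
  qed
  have "\<forall>Q\<in>H. \<exists>v. v \<in> Q"
  proof
    fix Q assume "Q \<in> H"
    then have "card Q > 0" using Q(3,4) by (simp add: H_def)
    then show "\<exists>v. v \<in> Q" by (auto simp: card_gt_0_iff)
  qed
  then obtain v where v: "\<forall>Q\<in>H. v Q \<in> Q" by (rule bchoice[THEN exE])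
  have finH: "finite H" using Q(1) by (simp add: H_def)
  have "\<not> Q \<subseteq> A - v ` H" if "Q \<in> \<Q>" for Q
  proof
    assume sub: "Q \<subseteq> A - v ` H"
    then have "Q \<in> H" using that by (auto simp: H_def)
    then show False using sub v by blast
  qed
  moreover have "\<not> A - v ` H \<subseteq> F" if "F \<in> \<F>" for F
  proof
    assume "A - v ` H \<subseteq> F"
    then have "A - F \<subseteq> v ` H" by auto
    then have "card (A - F) \<le> card H"
      by (rule surj_card_le[OF finH])
    then show False using large[OF that] \<open>real (card H) < b\<close> by simp
  qed
  ultimately show ?thesis using A(1) by (intro exI[of _ "A - v ` H"]) auto
qed

section \<open>Ramsey numbers\<close>

text \<open>The neighbourhood-chasing argument with a target size \<open>s i\<close> for each colour: among the other vertices,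
  some colour class at \<open>v\<close> has at least a fraction of \<open>1 / k\<close> of the bound, and in it the target for
  that colour is lower by one. The pigeonhole step needs \<open>k \<ge> 2\<close> to absorb the removal of \<open>v\<close>.\<close>
lemma monochromatic_clique:
  fixes s :: "nat \<Rightarrow> nat"
  assumes k: "k \<ge> 2"
    and Y: "finite Y" "k ^ (\<Sum>i\<in>{1..k}. s i) \<le> card Y" and c: "c \<in> [Y]\<^bsup>2\<^esup> \<rightarrow> {1..k}"
  shows "\<exists>i\<in>{1..k}. \<exists>X\<subseteq>Y. card X = s i \<and> (\<forall>e\<in>[X]\<^bsup>2\<^esup>. c e = i)"
  using Y c
proof (induction "\<Sum>i\<in>{1..k}. s i" arbitrary: s Y)
  case 0
  have "s 1 = 0" using 0(1)[symmetric] k by (subst (asm) sum_eq_0_iff) auto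
  then have "\<exists>X\<subseteq>Y. card X = s 1 \<and> (\<forall>e\<in>[X]\<^bsup>2\<^esup>. c e = 1)"
    by (intro exI[of _ "{}"]) (simp add: nsets_empty_iff)
  then show ?case using k by (intro bexI[of _ 1]) auto
next
  case (Suc t s Y)
  show ?case
  proof (cases "\<exists>i\<in>{1..k}. s i = 0")
    case True
    then obtain i where "i \<in> {1..k}" "s i = 0" by blast
    then show ?thesis
      by (intro bexI[of _ i] exI[of _ "{}"]) (simp_all add: nsets_empty_iff)
  next
    case False
    have "Y \<noteq> {}" using Suc.prems(2) k by auto
    then obtain v where v: "v \<in> Y" by blast
    define N where "N i = {y\<in>Y - {v}. c {v, y} = i}" for i
    have finN: "finite (N i)" for i using Suc.prems(1) by (simp add: N_def)
    have "Y - {v} = (\<Union>i\<in>{1..k}. N i)"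
    proof -
      have "c {v, y} \<in> {1..k}" if "y \<in> Y - {v}" for y
        using Suc.prems(3) v that by (auto simp: Pi_iff)
      then show ?thesis unfolding N_def by blast
    qed
    moreover have "card (\<Union>i\<in>{1..k}. N i) = (\<Sum>i\<in>{1..k}. card (N i))"
      using finN by (intro card_UN_disjoint) (auto simp: N_def)
    ultimately have cardY: "card Y = Suc (\<Sum>i\<in>{1..k}. card (N i))"
      using Suc.prems(1) v by (metis card_Suc_Diff1)
    have "\<exists>i\<in>{1..k}. k ^ t \<le> card (N i)"
    proof (rule ccontr)
      assume "\<not> ?thesis"
      then have "(\<Sum>i\<in>{1..k}. Suc (card (N i))) \<le> (\<Sum>i\<in>{1..k}. k ^ t)"
        by (intro sum_mono) (auto simp: not_le Suc_leI)
      then have "(\<Sum>i\<in>{1..k}. card (N i)) + k \<le> k * k ^ t"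
        by (simp add: sum_Suc)
      moreover have "k * k ^ t \<le> card Y" using Suc.prems(2) Suc.hyps(2) by (metis power_Suc)
      ultimately show False using cardY k by simp
    qed
    then obtain i where i: "i \<in> {1..k}" "k ^ t \<le> card (N i)" by blast
    define s' where "s' = s(i := s i - 1)"
    have "s i > 0" using False i by auto
    have "(\<Sum>j\<in>{1..k}. s j) = s i + (\<Sum>j\<in>{1..k} - {i}. s j)"
      using i by (intro sum.remove) auto
    moreover have "(\<Sum>j\<in>{1..k}. s' j) = s' i + (\<Sum>j\<in>{1..k} - {i}. s' j)"
      using i by (intro sum.remove) auto
    moreover have "(\<Sum>j\<in>{1..k} - {i}. s' j) = (\<Sum>j\<in>{1..k} - {i}. s j)"
      by (intro sum.cong) (auto simp: s'_def)
    ultimately have t: "t = (\<Sum>j\<in>{1..k}. s' j)"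
      using \<open>s i > 0\<close> Suc.hyps(2) by (simp add: s'_def)
    have NY: "N i \<subseteq> Y" by (auto simp: N_def)
    then have "c \<in> [N i]\<^bsup>2\<^esup> \<rightarrow> {1..k}" using Suc.prems(3) nsets_mono[OF NY] by (auto simp: Pi_iff)
    then obtain j X where j: "j \<in> {1..k}" and X: "X \<subseteq> N i" "card X = s' j" "\<And>e. e \<in> [X]\<^bsup>2\<^esup> \<Longrightarrow> c e = j"
      using Suc.hyps(1)[OF t finN[of i]] i(2) t by metis
    show ?thesis
    proof (cases "j = i")
      case False
      then show ?thesis using X NY by (intro bexI[OF _ j] exI[of _ X]) (auto simp: s'_def)
    next
      case True
      have "v \<notin> X" "finite X" using X(1) finN by (auto simp: N_def intro: finite_subset)
      then have "card (insert v X) = s i" using X(2) True \<open>s i > 0\<close> by (simp add: s'_def)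
      moreover have "c e = i" if "e \<in> [insert v X]\<^bsup>2\<^esup>" for e
      proof (cases "v \<in> e")
        case True
        then obtain y where "e = {v, y}" "y \<in> X"
          using \<open>e \<in> [insert v X]\<^bsup>2\<^esup>\<close> by (auto simp: nsets_2_eq)
        then show ?thesis using X(1) by (auto simp: N_def)
      next
        case False
        then have "e \<in> [X]\<^bsup>2\<^esup>" using that by (auto simp: nsets_def)
        then show ?thesis using X(3) True by simp
      qed
      ultimately show ?thesis
        using i(1) v X(1) NY by (intro bexI[OF _ i(1)] exI[of _ "insert v X"]) auto
    qed
  qed
qed

lemma is_graph_complete_graph: "is_graph (complete_graph N)"
  by (simp add: is_graph_def complete_graph_def)

lemma ramsey_arrow_complete_self:
  assumes "n = 1 \<or> n = 2" "k \<ge> 1"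
  shows "ramsey_arrow (complete_graph n) (complete_graph n) k"
  unfolding ramsey_arrow_def
proof
  fix c assume c: "c \<in> edges (complete_graph n) \<rightarrow> {1..k}"
  have E: "[{..<n}]\<^bsup>2\<^esup> = (if n = 1 then {} else {{0, 1}})"
  proof (cases "n = 1")
    case True
    then show ?thesis by (simp add: lessThan_Suc nsets_singleton_iff)
  next
    case False
    moreover have "{..<2 :: nat} = {0, 1}" by auto
    ultimately show ?thesis using assms(1) by auto
  qed
  define i where "i = (if n = 1 then 1 else c {0, 1})"
  have "i \<in> {1..k}" using assms(2) c by (auto simp: i_def complete_graph_def E)
  moreover have "[{..<n}]\<^bsup>2\<^esup> \<subseteq> {e \<in> [{..<n}]\<^bsup>2\<^esup>. c e = i}"
    by (simp add: E i_def)
  then have "contains_graph (colour_class (complete_graph n) c i) (complete_graph n)"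
    unfolding contains_complete_graph_iff
    by (intro exI[of _ "{..<n}"]) (simp add: colour_class_def complete_graph_def)
  ultimately show "\<exists>i\<in>{1..k}. contains_graph (colour_class (complete_graph n) c i) (complete_graph n)"
    by blast
qed

lemma ramsey_arrow_power:
  assumes "n \<ge> 2" "k \<ge> 2"
  shows "ramsey_arrow (complete_graph (k ^ (k * n))) (complete_graph n) k"
  unfolding ramsey_arrow_iff[OF assms(1) is_graph_complete_graph] clique_free_colourable_def
proof
  let ?Y = "{..<k ^ (k * n)}"
  assume "\<exists>c\<in>edges (complete_graph (k ^ (k * n))) \<rightarrow> {1..k}.
    \<forall>i\<in>{1..k}. clique_free n {e \<in> edges (complete_graph (k ^ (k * n))). c e = i}"
  then obtain c where c: "c \<in> [?Y]\<^bsup>2\<^esup> \<rightarrow> {1..k}" "\<And>i. i \<in> {1..k} \<Longrightarrow> clique_free n {e \<in> [?Y]\<^bsup>2\<^esup>. c e = i}"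
    by (auto simp: complete_graph_def)
  then obtain i X where i: "i \<in> {1..k}" and X: "X \<subseteq> ?Y" "card X = n" "\<And>e. e \<in> [X]\<^bsup>2\<^esup> \<Longrightarrow> c e = i"
    using monochromatic_clique[OF assms(2), of ?Y "\<lambda>_. n" c] by auto
  have "[X]\<^bsup>2\<^esup> \<subseteq> {e \<in> [?Y]\<^bsup>2\<^esup>. c e = i}" using X(3) nsets_mono[OF X(1)] by auto
  moreover have "finite X" using X(1) by (rule finite_subset) simp
  ultimately show False using c(2)[OF i] X(2) by (auto simp: clique_free_def)
qed

text \<open>A colouring with fewer colours is one in which the remaining colour classes are empty. This reaches
  the case of a single colour from that of two.\<close>
lemma ramsey_arrow_fewer_colours:
  assumes "ramsey_arrow G H k" "j \<le> k" "\<not> contains_graph (verts G, {}) H"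
  shows "ramsey_arrow G H j"
  unfolding ramsey_arrow_def
proof
  fix c assume c: "c \<in> edges G \<rightarrow> {1..j}"
  then have "c \<in> edges G \<rightarrow> {1..k}" using assms(2) by (auto simp: Pi_iff)
  then obtain i where i: "i \<in> {1..k}" "contains_graph (colour_class G c i) H"
    using assms(1) by (auto simp: ramsey_arrow_def)
  have "i \<le> j"
  proof (rule ccontr)
    assume "\<not> i \<le> j"
    then have "{e \<in> edges G. c e = i} = {}" using c by (auto simp: Pi_iff)
    then show False using i(2) assms(3) unfolding colour_class_def by metis
  qed
  then show "\<exists>i\<in>{1..j}. contains_graph (colour_class G c i) H" using i by auto
qed

lemma ex_ramsey_arrow:
  assumes "n \<ge> 1" "k \<ge> 1"
  shows "\<exists>N. ramsey_arrow (complete_graph N) (complete_graph n) k"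
proof (cases "n = 1")
  case True
  then show ?thesis using ramsey_arrow_complete_self[of n k] assms by blast
next
  case False
  then have n: "n \<ge> 2" using assms by simp
  let ?k = "Suc k"
  have "\<not> contains_graph (verts (complete_graph (?k ^ (?k * n))), {}) (complete_graph n)"
    using n by (auto simp: contains_complete_graph_iff nsets_eq_empty_iff)
  then have "ramsey_arrow (complete_graph (?k ^ (?k * n))) (complete_graph n) k"
    using ramsey_arrow_fewer_colours[OF ramsey_arrow_power[OF n, of ?k]] assms by simp
  then show ?thesis by blast
qed

lemma ramsey_arrow_ramsey_number:
  "n \<ge> 1 \<Longrightarrow> k \<ge> 1 \<Longrightarrow> ramsey_arrow (complete_graph (ramsey_number n k)) (complete_graph n) k"
  unfolding ramsey_number_def by (rule LeastI_ex) (rule ex_ramsey_arrow)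

lemma ramsey_number_ge:
  assumes "n \<ge> 1" "k \<ge> 1"
  shows "n \<le> ramsey_number n k"
proof -
  let ?K = "complete_graph (ramsey_number n k)"
  have "(\<lambda>_. 1) \<in> edges ?K \<rightarrow> {1..k}" using assms by auto
  then obtain i where "contains_graph (colour_class ?K (\<lambda>_. 1) i) (complete_graph n)"
    using ramsey_arrow_ramsey_number[OF assms] unfolding ramsey_arrow_def by blast
  then obtain X where "X \<subseteq> {..<ramsey_number n k}" "card X = n"
    unfolding contains_complete_graph_iff by (auto simp: colour_class_def complete_graph_def)
  then show ?thesis using card_mono[of "{..<ramsey_number n k}" X] by simp
qed

lemma ramsey_number_le_power:
  assumes "n \<ge> 1" "k \<ge> 2"
  shows "ramsey_number n k \<le> k ^ (k * n)"
proof (cases "n = 1")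
  case True
  then have "ramsey_number n k \<le> 1"
    unfolding ramsey_number_def using ramsey_arrow_complete_self[of n k] assms by (intro Least_le) auto
  also have "\<dots> \<le> k ^ (k * n)" using assms by simp
  finally show ?thesis .
next
  case False
  then show ?thesis
    unfolding ramsey_number_def using ramsey_arrow_power assms by (intro Least_le) auto
qed

lemma folkman_number_le:
  assumes "subgraph G (complete_graph N)" "\<not> contains_graph G (complete_graph (n + 1))"
    "ramsey_arrow G (complete_graph n) k"
  shows "folkman_number n k \<le> enat N"
  unfolding folkman_number_def using assms by (intro INF_lower) blast

lemma folkman_number_le_small:
  assumes "n = 1 \<or> n = 2" "k \<ge> 1"
  shows "folkman_number n k \<le> enat n"
proof (rule folkman_number_le)
  show "\<not> contains_graph (complete_graph n) (complete_graph (n + 1))"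
  proof
    assume "contains_graph (complete_graph n) (complete_graph (n + 1))"
    then obtain X where "X \<subseteq> {..<n}" "card X = n + 1"
      unfolding contains_complete_graph_iff by (auto simp: complete_graph_def)
    then show False using card_mono[of "{..<n}" X] by simp
  qed
qed (use assms ramsey_arrow_complete_self in \<open>auto simp: subgraph_def is_graph_complete_graph\<close>)

section \<open>The bound on Folkman numbers\<close>

lemma monomial_le_power:
  fixes x y z :: real
  assumes "1 \<le> x" "1 \<le> y" "1 \<le> z" "a \<le> d" "b \<le> d" "c \<le> d"
  shows "x ^ a * y ^ b * z ^ c \<le> (x * y * z) ^ d"
  unfolding power_mult_distrib using assms by (intro mult_mono power_increasing mult_nonneg_nonneg) auto

text \<open>All parameters are powers of \<open>M\<close>. The containers require \<open>r ^ (n + 1) \<ge> n R / N\<close>, for which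
  \<open>r ^ (n + 1) \<ge> M / N\<close> suffices, and \<open>p\<close> has to exceed \<open>r\<^sup>2\<close> by a polynomial factor, here \<open>M ^ 6\<close>, to
  outweigh the number of containers. With \<open>p = u\<^sup>2\<close>, the copies of \<open>K\<^sub>n\<^sub>+\<^sub>1\<close> are outnumbered by the missing
  edges once \<open>N * u ^ (n + 2) \<le> 1 / M\<close>. With \<open>r = M powr - a\<close>, \<open>u = M powr (3 - a)\<close> and \<open>N = M powr e\<close> the two conditions
  become \<open>e \<ge> 1 + a (n + 1)\<close> and \<open>e \<le> (a - 3) (n + 2) - 1\<close>. The smallest solution is \<open>a = 3 n + 8\<close>,
  \<open>e = 3 n\<^sup>2 + 11 n + 9\<close>, with equality in both.\<close>
lemma folkman_number_le_power:
  assumes n: "n \<ge> 3" and k: "k \<ge> 1"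
  shows "folkman_number n k \<le> enat ((2048 * k * n * ramsey_number n k) ^ (3 * n\<^sup>2 + 11 * n + 9))"
proof -
  define R where "R = ramsey_number n k"
  define M where "M = 2048 * k * n * R"
  define N where "N = M ^ (3 * n\<^sup>2 + 11 * n + 9)"
  define P where "P = real M"
  define r where "r = 1 / P ^ (3 * n + 8)"
  define u where "u = 1 / P ^ (3 * n + 5)"
  define p where "p = u\<^sup>2"
  define t where "t = 2 * real k * real n ^ 3 * real R ^ 2 * r\<^sup>2 * real N ^ 2"
  define b where "b = p * (real N / real R)\<^sup>2 / 16"
  define W where "W = {..<N}"
  have nR: "n \<le> R" using ramsey_number_ge[of n k] n k by (simp add: R_def)
  have k1: "1 \<le> real k" "1 \<le> real n" "1 \<le> real R" using n k nR by auto
  have P: "P = 2048 * (real k * real n * real R)" by (simp add: P_def M_def)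
  have knR1: "1 \<le> real k * real n * real R"
    using monomial_le_power[OF k1, of 0 1 0 0] by simp
  then have P1: "2048 \<le> P" by (simp add: P)
  have monomial: "2048 ^ d * (real k ^ a * real n ^ b * real R ^ c) \<le> P ^ d"
    if "a \<le> d" "b \<le> d" "c \<le> d" for a b c d
    unfolding P power_mult_distrib[of 2048] using monomial_le_power[OF k1 that] by simp
  have NP: "real N = P ^ (3 * n\<^sup>2 + 11 * n + 9)" by (simp add: N_def P_def)
  have "M \<le> N" using P1 by (simp add: N_def P_def self_le_power)
  moreover have "R \<le> M"
    using mult_le_mono1[of 1 "2048 * k * n" R] n k by (simp add: M_def)
  ultimately have "R \<le> N" by (rule le_trans[rotated])
  have N0: "N > 0" using \<open>R \<le> N\<close> nR n by simp
  have W: "finite W" "card W = N" by (simp_all add: W_def)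
  have r0: "0 < r" and u0: "0 < u" "u \<le> 1" and p0: "0 < p" "p \<le> 1"
    using P1 by (auto simp: r_def u_def p_def power_le_one one_le_power)

  have r_N: "real n * real R / real N \<le> r ^ (n + 1)"
  proof -
    have "0 \<le> real n * real R" by simp
    moreover have "2048 * (real n * real R) \<le> P" using monomial[of 0 1 1 1] by simp
    ultimately have "real n * real R \<le> P" by linarith
    then have "real n * real R / real N \<le> P / N" by (rule divide_right_mono) simp
    also have "\<dots> = 1 / P ^ ((3 * n + 8) * (n + 1))"
    proof -
      have "3 * n\<^sup>2 + 11 * n + 9 = Suc ((3 * n + 8) * (n + 1))"
        by (simp add: power2_eq_square algebra_simps)
      then have "real N = P * P ^ ((3 * n + 8) * (n + 1))" unfolding NP by (simp only: power_Suc)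
      then show ?thesis using P1 by simp
    qed
    also have "\<dots> = r ^ (n + 1)" by (simp only: r_def power_one_over power_mult)
    finally show ?thesis .
  qed
  have r2: "r\<^sup>2 = 1 / P ^ (6 * n + 16)"
    by (simp add: r_def power_one_over flip: power_mult)
  have p: "p = 1 / P ^ (6 * n + 10)"
    by (simp add: p_def u_def power_one_over flip: power_mult)
  have r2_p: "r\<^sup>2 * P ^ 6 = p"
  proof -
    have "P ^ (6 * n + 16) = P ^ (6 * n + 10) * P ^ 6"
      unfolding power_add[symmetric] by (rule arg_cong[of _ _ "power P"]) simp
    then show ?thesis using P1 by (simp add: r2 p)
  qed
  have r_small: "8 * real k ^ 2 * real n ^ 3 * real R ^ 4 * r\<^sup>2 \<le> 1"
  proof -
    have "8 * (real k ^ 2 * real n ^ 3 * real R ^ 4) \<le> 2048 ^ 4 * (real k ^ 2 * real n ^ 3 * real R ^ 4)"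
      by (intro mult_right_mono) auto
    also have "\<dots> \<le> P ^ 4" using monomial[of 2 4 3 4] by simp
    also have "\<dots> \<le> P ^ (6 * n + 16)" using P1 by (intro power_increasing) auto
    finally show ?thesis using P1 by (simp add: r2 pos_divide_le_eq mult.assoc)
  qed
  have "\<not> clique_free_colourable n k ([{..<R}]\<^bsup>2\<^esup>)"
    using ramsey_arrow_ramsey_number[of n k] n k
    by (simp add: ramsey_arrow_iff is_graph_complete_graph R_def) (simp add: complete_graph_def)
  then obtain \<F> where \<F>: "finite \<F>" "card \<F> \<le> ((N choose 2) + 1) ^ (nat \<lfloor>t\<rfloor> * k)"
    "\<And>F. F \<in> \<F> \<Longrightarrow> (real N / real R)\<^sup>2 / 2 \<le> card ([W]\<^bsup>2\<^esup> - F)"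
    "\<And>G. G \<subseteq> [W]\<^bsup>2\<^esup> \<Longrightarrow> clique_free_colourable n k G \<Longrightarrow> \<exists>F\<in>\<F>. G \<subseteq> F"
    using colourable_container_family[OF W n nR \<open>R \<le> N\<close> k _ r0 r_N r_small, of t] unfolding t_def by blast

  define \<Q> where "\<Q> = (\<lambda>X. [X]\<^bsup>2\<^esup>) ` nsets W (n + 1)"
  have "\<exists>G\<subseteq>[W]\<^bsup>2\<^esup>. (\<forall>Q\<in>\<Q>. \<not> Q \<subseteq> G) \<and> (\<forall>F\<in>\<F>. \<not> G \<subseteq> F)"
  proof (rule random_subset_deletion)
    show "finite ([W]\<^bsup>2\<^esup>)" "finite \<Q>" using W by (simp_all add: \<Q>_def finite_imp_finite_nsets)
    show "0 \<le> p" "p \<le> 1" using p0 by auto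
    show "Q \<subseteq> [W]\<^bsup>2\<^esup>" if "Q \<in> \<Q>" for Q
    proof -
      obtain X where "X \<in> nsets W (n + 1)" "Q = [X]\<^bsup>2\<^esup>" using \<open>Q \<in> \<Q>\<close> unfolding \<Q>_def by blast
      then show ?thesis using nsets_mono[of X W 2] by (simp add: nsets_def)
    qed
    show "card Q = (n + 1) choose 2" if "Q \<in> \<Q>" for Q
    proof -
      obtain X where "X \<in> nsets W (n + 1)" "Q = [X]\<^bsup>2\<^esup>" using \<open>Q \<in> \<Q>\<close> unfolding \<Q>_def by blast
      then show ?thesis using card_nsets_eq[of X 2] by (simp add: nsets_def[of W])
    qed
    show "(n + 1) choose 2 > 0" using n by simp
    show "finite \<F>" by fact
    show "8 * b \<le> p * card ([W]\<^bsup>2\<^esup> - F)" if "F \<in> \<F>" for F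
      using mult_left_mono[OF \<F>(3)[OF that], of p] p0 by (simp add: b_def)
    show "2 * card \<Q> * p ^ ((n + 1) choose 2) \<le> b"
    proof -
      have "card \<Q> \<le> N choose (n + 1)"
        unfolding \<Q>_def using card_image_le[of "nsets W (n + 1)" "\<lambda>X. [X]\<^bsup>2\<^esup>"] W
        by (simp add: finite_imp_finite_nsets card_nsets_eq)
      also have "\<dots> \<le> N ^ (n + 1)"
        using binomial_fact_pow[of N "n + 1"] fact_ge_1[of "n + 1"]
        by (metis mult.right_neutral mult_le_mono2 le_trans)
      finally have "real (card \<Q>) \<le> real (N ^ (n + 1))" by (rule of_nat_mono)
      then have "2 * card \<Q> * p ^ ((n + 1) choose 2) \<le> 2 * N ^ (n + 1) * p ^ ((n + 1) choose 2)"
        using p0 by (intro mult_right_mono) auto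
      also have "\<dots> = 2 * (real N ^ 2 * p) * (N * u ^ (n + 2)) ^ (n - 1)"
      proof -
        obtain l where l: "n = l + 1" using n by (metis add.commute le_Suc_ex le_trans one_le_numeral)
        have "2 * ((n + 1) choose 2) = (n + 1) * n" using times_binomial_minus1_eq[of 2 "n + 1"] by simp
        then have "2 * ((n + 1) choose 2) = 2 + (n + 2) * l" by (simp add: l algebra_simps)
        then have "p ^ ((n + 1) choose 2) = p * (u ^ (n + 2)) ^ l"
          unfolding p_def power_mult[symmetric] power_add[symmetric] by simp
        moreover have "real N ^ (n + 1) = real N ^ 2 * real N ^ l" by (simp add: l power2_eq_square)
        ultimately show ?thesis by (simp add: l power_mult_distrib power2_eq_square)
      qed
      also have "N * u ^ (n + 2) = 1 / P"
      proof -
        have "(3 * n + 5) * (n + 2) = Suc (3 * n\<^sup>2 + 11 * n + 9)"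
          by (simp add: power2_eq_square algebra_simps)
        then have "u ^ (n + 2) = 1 / (P * real N)"
          unfolding u_def power_one_over power_mult[symmetric] NP by (simp only: power_Suc)
        then show ?thesis using N0 by simp
      qed
      also have "2 * (real N ^ 2 * p) * (1 / P) ^ (n - 1) \<le> 2 * (real N ^ 2 * p) * (1 / P) ^ 2"
        using n P1 p0 by (intro mult_left_mono power_decreasing) auto
      also have "\<dots> \<le> 2 * (real N ^ 2 * p) * (1 / (32 * real R ^ 2))"
      proof -
        have "32 * real R ^ 2 \<le> 2048 ^ 2 * real R ^ 2" by (intro mult_right_mono) auto
        also have "\<dots> \<le> P ^ 2" using monomial[of 0 2 0 2] by simp
        finally have "1 / P ^ 2 \<le> 1 / (32 * real R ^ 2)"
          using k1 P1 by (intro divide_left_mono) auto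
        then show ?thesis using p0 by (intro mult_left_mono) (auto simp: power_one_over)
      qed
      also have "\<dots> = b" by (simp add: b_def power_divide)
      finally show ?thesis by simp
    qed
    show "b \<ge> 2"
    proof -
      have "32 * real R ^ 2 \<le> 2048 ^ 2 * real R ^ 2" by (intro mult_right_mono) auto
      also have "\<dots> \<le> P ^ 2" using monomial[of 0 2 0 2] by simp
      also have "\<dots> \<le> p * real N ^ 2"
      proof -
        have "real N ^ 2 = P ^ (6 * n + 10) * P ^ (6 * n\<^sup>2 + 16 * n + 8)"
          unfolding NP power_mult[symmetric] power_add[symmetric]
          by (rule arg_cong[of _ _ "power P"]) simp
        then have "p * real N ^ 2 = P ^ (6 * n\<^sup>2 + 16 * n + 8)" using P1 by (simp add: p)
        then show ?thesis using P1 by (simp only:) (intro power_increasing, simp_all)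
      qed
      finally have "2 * (16 * real R ^ 2) \<le> p * real N ^ 2" by simp
      moreover have "b = p * real N ^ 2 / (16 * real R ^ 2)" by (simp add: b_def power_divide)
      moreover have "0 < 16 * real R ^ 2" using k1 by simp
      ultimately show ?thesis by (simp only: pos_le_divide_eq)
    qed
    show "card \<F> \<le> exp (2 * b)"
    proof -
      have N2: "(N choose 2) + 1 \<le> N\<^sup>2"
      proof -
        obtain m where m: "N = Suc m" using N0 gr0_conv_Suc by blast
        then have "2 * (N choose 2) = m * m + m" using times_binomial_minus1_eq[of 2 N] by simp
        then show ?thesis by (simp add: m power2_eq_square)
      qed
      have ln_N: "ln N \<le> 8 * n\<^sup>2 * P"
      proof -
        have "ln N = real (3 * n\<^sup>2 + 11 * n + 9) * ln P"
          unfolding NP using P1 by (simp add: ln_realpow)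
        also have "\<dots> \<le> real (8 * n\<^sup>2) * P"
        proof (intro mult_mono of_nat_mono)
          have "11 * n \<le> 4 * n\<^sup>2" "9 \<le> n\<^sup>2"
            using n mult_le_mono[of 3 n 3 n] mult_le_mono1[of 3 n n] unfolding power2_eq_square by linarith+
          then show "3 * n\<^sup>2 + 11 * n + 9 \<le> 8 * n\<^sup>2" by linarith
          show "ln P \<le> P" using P1 ln_le_minus_one[of P] by simp
        qed (use P1 in auto)
        finally show ?thesis by simp
      qed
      have "real (card \<F>) \<le> real (N\<^sup>2) ^ (nat \<lfloor>t\<rfloor> * k)"
        using \<F>(2) power_mono[OF N2, of "nat \<lfloor>t\<rfloor> * k"] by (metis of_nat_mono of_nat_power order_trans zero_le)
      also have "\<dots> = exp (ln N * (2 * real (nat \<lfloor>t\<rfloor> * k)))"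
        using N0 by (simp add: exp_of_nat2_mult ln_realpow powr_def flip: powr_realpow)
      also have "\<dots> \<le> exp ((8 * n\<^sup>2 * P) * (2 * (t * k)))"
      proof -
        have "t \<ge> 0" by (simp add: t_def)
        then have "real (nat \<lfloor>t\<rfloor>) \<le> t" by simp
        then have "real (nat \<lfloor>t\<rfloor> * k) \<le> t * k" by (simp add: mult_right_mono)
        moreover have "0 \<le> ln N" using N0 by simp
        ultimately have "ln N * (2 * real (nat \<lfloor>t\<rfloor> * k)) \<le> (8 * n\<^sup>2 * P) * (2 * (t * k))"
          using ln_N P1 by (intro mult_mono) auto
        then show ?thesis by simp
      qed
      also have "(8 * n\<^sup>2 * P) * (2 * (t * k)) = (256 * (real k ^ 2 * real n ^ 5 * real R ^ 4)) * P * (r\<^sup>2 * (real N / real R)\<^sup>2 / 8)"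
        using k1 by (simp add: t_def field_simps eval_nat_numeral)
      also have "\<dots> \<le> P ^ 5 * P * (r\<^sup>2 * (real N / real R)\<^sup>2 / 8)"
      proof -
        have "256 * (real k ^ 2 * real n ^ 5 * real R ^ 4) \<le> 2048 ^ 5 * (real k ^ 2 * real n ^ 5 * real R ^ 4)"
          by (intro mult_right_mono) auto
        also have "\<dots> \<le> P ^ 5" using monomial[of 2 5 5 4] by simp
        finally show ?thesis using P1 by (intro mult_right_mono) auto
      qed
      also have "\<dots> = (r\<^sup>2 * P ^ 6) * (real N / real R)\<^sup>2 / 8" by (simp add: eval_nat_numeral)
      also have "\<dots> = 2 * b" unfolding r2_p by (simp add: b_def)
      finally show ?thesis by simp
    qed
  qed
  then obtain G where G: "G \<subseteq> [W]\<^bsup>2\<^esup>" "\<forall>Q\<in>\<Q>. \<not> Q \<subseteq> G" "\<forall>F\<in>\<F>. \<not> G \<subseteq> F"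
    by (elim exE conjE)
  have "folkman_number n k \<le> enat N"
  proof (rule folkman_number_le)
    show "subgraph (W, G) (complete_graph N)"
      using G(1) by (simp add: subgraph_def is_graph_def complete_graph_def W_def)
    show "\<not> contains_graph (W, G) (complete_graph (n + 1))"
    proof
      assume "contains_graph (W, G) (complete_graph (n + 1))"
      then obtain X where X: "X \<subseteq> W" "finite X" "card X = n + 1" "[X]\<^bsup>2\<^esup> \<subseteq> G"
        unfolding contains_complete_graph_iff fst_conv snd_conv by blast
      then have "X \<in> nsets W (n + 1)" by (simp add: nsets_def)
      then have "[X]\<^bsup>2\<^esup> \<in> \<Q>" unfolding \<Q>_def by (rule imageI)
      with G(2) X(4) show False by blast
    qed
    have "\<not> clique_free_colourable n k G"
    proof
      assume "clique_free_colourable n k G"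
      then obtain F where "F \<in> \<F>" "G \<subseteq> F" using \<F>(4)[OF G(1)] by blast
      with G(3) show False by blast
    qed
    then show "ramsey_arrow (W, G) (complete_graph n) k"
      using ramsey_arrow_iff[of n "(W, G)" k] n G(1) by (simp add: is_graph_def)
  qed
  then show ?thesis by (simp add: N_def M_def R_def)
qed

text \<open>Taking logarithms, each of the four factors contributes at most a constant multiple of
  \<open>k n ln k\<close>; the dominant one is \<open>R \<le> k ^ (k * n)\<close>.\<close>
lemma ramsey_power_le_exp:
  assumes n: "n \<ge> 1" and k: "k \<ge> 2"
  shows "(2048 * real k * real n * real (ramsey_number n k)) ^ (21 * n ^ 2)
        \<le> exp (2048 * real k * real n ^ 3 * ln (real k))"
proof -
  define R where "R = ramsey_number n k"
  define L where "L = real k * real n * ln (real k)"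
  have R: "1 \<le> R" "real R \<le> real k ^ (k * n)"
    using ramsey_number_ge[of n k] ramsey_number_le_power[OF n k] n k
    by (auto simp: R_def simp flip: of_nat_power)
  have "ln (2::real) \<le> ln k" using k by simp
  moreover have "1 / 2 \<le> ln (2::real)" using ln_le_minus_one[of "1 / 2 :: real"] by (simp add: ln_div)
  ultimately have lnk: "1 / 2 \<le> ln (real k)" by linarith
  have kn: "2 \<le> real k" "1 \<le> real n" using n k by auto
  have L1: "real n \<le> L"
  proof -
    have "real n * 1 \<le> real n * (real k * ln (real k))"
      using kn lnk mult_mono[of 2 "real k" "1 / 2" "ln (real k)"] by (intro mult_left_mono) auto
    then show ?thesis by (simp add: L_def mult_ac)
  qed
  have "ln (2048 :: real) = 11 * ln 2" using ln_realpow[of 2 11] by simp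
  also have "\<dots> \<le> 11 * 1" using ln_le_minus_one[of "2 :: real"] by simp
  finally have 1: "ln (2048 :: real) \<le> 11 * L" using L1 kn by linarith
  have "1 * ln (real k) \<le> (real k * real n) * ln (real k)"
    using kn lnk mult_mono[of 1 "real k" 1 "real n"] by (intro mult_right_mono) auto
  then have 2: "ln (real k) \<le> L" by (simp add: L_def)
  have 3: "ln (real n) \<le> L" using ln_le_minus_one[of "real n"] kn L1 by linarith
  have "ln (real R) \<le> ln (real k ^ (k * n))" using R kn by (intro ln_mono) auto
  also have "\<dots> = L" using kn by (simp add: ln_realpow L_def)
  finally have 4: "ln (real R) \<le> L" .
  have "ln (2048 * real k * real n * real R) = ln 2048 + ln (real k) + ln (real n) + ln (real R)"
    using kn R by (simp add: ln_mult)
  also have "\<dots> \<le> 14 * L" using 1 2 3 4 by linarith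
  finally have ln_le: "ln (2048 * real k * real n * real R) \<le> 14 * L" .
  have pos: "0 < 2048 * real k * real n * real R" using kn R by simp
  have "(2048 * real k * real n * real R) ^ (21 * n\<^sup>2)
      = exp (real (21 * n\<^sup>2) * ln (2048 * real k * real n * real R))"
    using pos by (simp only: exp_of_nat_mult exp_ln)
  also have "\<dots> \<le> exp (real (21 * n\<^sup>2) * (14 * L))"
    unfolding exp_le_cancel_iff by (intro mult_left_mono ln_le) simp
  also have "\<dots> \<le> exp (2048 * real k * real n ^ 3 * ln (real k))"
  proof -
    have "real (21 * n\<^sup>2) * (14 * L) = 294 * (real k * real n ^ 3 * ln (real k))"
      by (simp add: L_def power2_eq_square power3_eq_cube)
    also have "\<dots> \<le> 2048 * (real k * real n ^ 3 * ln (real k))"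
      using lnk by (intro mult_right_mono) auto
    finally show ?thesis by (simp add: mult.assoc)
  qed
  finally show ?thesis by (simp add: R_def)
qed

theorem theorem1p4:
  shows "\<exists>C::real. \<forall>n k :: nat. n \<ge> 1 \<longrightarrow> k \<ge> 1 \<longrightarrow>
    ereal_of_enat (folkman_number n k)
      \<le> ereal ((C * real k * real n * real (ramsey_number n k)) ^ (21 * n ^ 2)) \<and>
    (k \<ge> 2 \<longrightarrow>
      (C * real k * real n * real (ramsey_number n k)) ^ (21 * n ^ 2)
        \<le> exp (C * real k * real n ^ 3 * ln (real k)))"
proof (intro exI[of _ 2048] allI impI conjI)
  fix n k :: nat
  assume n: "n \<ge> 1" and k: "k \<ge> 1"
  define M where "M = 2048 * k * n * ramsey_number n k"
  have R: "n \<le> ramsey_number n k" by (rule ramsey_number_ge[OF n k])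
  have "n * 1 \<le> n * (2048 * k * ramsey_number n k)"
    using n k R by (intro mult_le_mono2) auto
  then have M: "n \<le> M" by (simp add: M_def mult_ac)
  have "folkman_number n k \<le> enat (M ^ (21 * n\<^sup>2))"
  proof (cases "n \<ge> 3")
    case True
    have "3 * n\<^sup>2 + 11 * n + 9 \<le> 21 * n\<^sup>2"
      using True mult_le_mono[of 3 n 3 n] mult_le_mono1[of 3 n n] unfolding power2_eq_square by linarith
    then have "M ^ (3 * n\<^sup>2 + 11 * n + 9) \<le> M ^ (21 * n\<^sup>2)"
      using M n by (intro power_increasing) auto
    then show ?thesis
      using folkman_number_le_power[OF True k] unfolding M_def
      by (meson enat_ord_simps(1) order_trans)
  next
    case False
    then have "folkman_number n k \<le> enat n"
      using n k by (intro folkman_number_le_small) auto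
    moreover have "M \<le> M ^ (21 * n\<^sup>2)" using M n by (intro self_le_power) auto
    ultimately show ?thesis using M by (meson enat_ord_simps(1) order_trans)
  qed
  then have "ereal_of_enat (folkman_number n k) \<le> ereal_of_enat (enat (M ^ (21 * n\<^sup>2)))"
    by (simp only: ereal_of_enat_le_iff)
  then show "ereal_of_enat (folkman_number n k)
      \<le> ereal ((2048 * real k * real n * real (ramsey_number n k)) ^ (21 * n ^ 2))"
    by (simp add: M_def)
next
  fix n k :: nat
  assume "n \<ge> 1" "k \<ge> 2"
  then show "(2048 * real k * real n * real (ramsey_number n k)) ^ (21 * n ^ 2)
        \<le> exp (2048 * real k * real n ^ 3 * ln (real k))"
    by (rule ramsey_power_le_exp)
qed

end
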